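(* Let $H\in\{\text{house},\text{hammer},\text{diamond}\}$ and let $\mathcal{C}$ be the class of $(\text{bull},H)$-free graphs. Then $\mathcal{C}$ is perfect-Pollyanna.
   Context: Graphs are finite and simple; $G$ is $(F_1,F_2)$-free if it has no induced subgraph isomorphic to $F_1$ or $F_2$. A bull is a triangle with two disjoint pendant edges. A house is the complement of the path $P_5$. A hammer is obtained by identifying an end vertex of a path $P_3$ with a vertex of a triangle. A diamond is two triangles sharing exactly one edge ($K_4$ minus an edge). A graph is perfect if $\chi(H)=\omega(H)$ for all induced subgraphs $H$. $G$ is perfectly divisible if for every induced subgraph $H$ of $G$, $V(H)$ can be partitioned into $A,B$ with $H[A]$ perfect and $\omega(H[B])<\omega(H)$. A class is hereditary if it is closed under isomorphism and taking induced subgraphs. A class $\mathcal{C}$ is perfect-Pollyanna if $\mathcal{C}\cap\mathcal{G}$ is perfectly divisible (every member is perfectly divisible) for every hereditary class $\mathcal{G}$ in which every triangle-free graph is $3$-colorable. *)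

theory Defs
  imports Main
begin

record 'a graph =
  verts :: "'a set"
  edges :: "'a set set"

definition simple_graph :: "'a graph \<Rightarrow> bool" where
  "simple_graph G \<longleftrightarrow> finite (verts G) \<and> (\<forall>e\<in>edges G. e \<subseteq> verts G \<and> card e = 2)"

definition induced :: "'a graph \<Rightarrow> 'a set \<Rightarrow> 'a graph" where
  "induced G X = \<lparr>verts = X, edges = {e \<in> edges G. e \<subseteq> X}\<rparr>"

definition complement :: "'a graph \<Rightarrow> 'a graph" where
  "complement G =
     \<lparr>verts = verts G,
      edges = {{u, v} | u v. u \<in> verts G \<and> v \<in> verts G \<and> u \<noteq> v \<and> {u, v} \<notin> edges G}\<rparr>"

definition graph_iso :: "'a graph \<Rightarrow> 'b graph \<Rightarrow> bool" where
  "graph_iso G H \<longleftrightarrow> (\<exists>f. bij_betw f (verts G) (verts H) \<and>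
     (\<forall>u\<in>verts G. \<forall>v\<in>verts G. {u, v} \<in> edges G \<longleftrightarrow> {f u, f v} \<in> edges H))"

definition free_of :: "'a graph \<Rightarrow> 'b graph \<Rightarrow> bool" where
  "free_of G F \<longleftrightarrow> \<not> (\<exists>X\<subseteq>verts G. graph_iso (induced G X) F)"

definition clique :: "'a graph \<Rightarrow> 'a set \<Rightarrow> bool" where
  "clique G K \<longleftrightarrow> K \<subseteq> verts G \<and> (\<forall>u\<in>K. \<forall>v\<in>K. u \<noteq> v \<longrightarrow> {u, v} \<in> edges G)"

definition clique_number :: "'a graph \<Rightarrow> nat" where
  "clique_number G = Max {card K | K. clique G K}"

definition colorable :: "'a graph \<Rightarrow> nat \<Rightarrow> bool" where
  "colorable G k \<longleftrightarrow> (\<exists>c :: 'a \<Rightarrow> nat. (\<forall>v\<in>verts G. c v < k) \<and>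
     (\<forall>u\<in>verts G. \<forall>v\<in>verts G. {u, v} \<in> edges G \<longrightarrow> c u \<noteq> c v))"

definition chromatic_number :: "'a graph \<Rightarrow> nat" where
  "chromatic_number G = (LEAST k. colorable G k)"

definition perfect :: "'a graph \<Rightarrow> bool" where
  "perfect G \<longleftrightarrow>
     (\<forall>X\<subseteq>verts G. chromatic_number (induced G X) = clique_number (induced G X))"

(* The induced subgraph must be nonempty: no graph has clique number below that of the
   empty graph. Either part of the partition may be empty. *)
definition perfectly_divisible :: "'a graph \<Rightarrow> bool" where
  "perfectly_divisible G \<longleftrightarrow>
     (\<forall>X\<subseteq>verts G. X \<noteq> {} \<longrightarrow>
        (\<exists>A B. A \<union> B = X \<and> A \<inter> B = {} \<and> perfect (induced G A) \<and>
               clique_number (induced G B) < clique_number (induced G X)))"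

(* Graph classes are sets of graphs over one vertex type. For any infinite vertex type, every
   finite graph has an isomorphic copy there, so nothing is lost. *)
definition hereditary :: "'a graph set \<Rightarrow> bool" where
  "hereditary \<G> \<longleftrightarrow>
     (\<forall>G\<in>\<G>. simple_graph G) \<and>
     (\<forall>G\<in>\<G>. \<forall>G'. simple_graph G' \<and> graph_iso G G' \<longrightarrow> G' \<in> \<G>) \<and>
     (\<forall>G\<in>\<G>. \<forall>X\<subseteq>verts G. induced G X \<in> \<G>)"

definition path_graph :: "nat \<Rightarrow> nat graph" where
  "path_graph n = \<lparr>verts = {..<n}, edges = {{i, Suc i} | i. Suc i < n}\<rparr>"

definition triangle :: "nat graph" where
  "triangle = \<lparr>verts = {0, 1, 2}, edges = {{0, 1}, {0, 2}, {1, 2}}\<rparr>"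

(* triangle 0 1 2 with pendant edges 0-3 and 1-4 *)
definition bull :: "nat graph" where
  "bull = \<lparr>verts = {0, 1, 2, 3, 4}, edges = {{0, 1}, {0, 2}, {1, 2}, {0, 3}, {1, 4}}\<rparr>"

definition house :: "nat graph" where
  "house = complement (path_graph 5)"

(* triangle 0 1 2 and path 2-3-4, sharing the vertex 2 *)
definition hammer :: "nat graph" where
  "hammer = \<lparr>verts = {0, 1, 2, 3, 4}, edges = {{0, 1}, {0, 2}, {1, 2}, {2, 3}, {3, 4}}\<rparr>"

(* triangles 0 1 2 and 1 2 3, sharing the edge 1-2 *)
definition diamond :: "nat graph" where
  "diamond = \<lparr>verts = {0, 1, 2, 3}, edges = {{0, 1}, {0, 2}, {1, 2}, {1, 3}, {2, 3}}\<rparr>"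

definition free_class :: "'b graph \<Rightarrow> 'c graph \<Rightarrow> 'a graph set" where
  "free_class F\<^sub>1 F\<^sub>2 = {G. simple_graph G \<and> free_of G F\<^sub>1 \<and> free_of G F\<^sub>2}"

definition perfect_pollyanna :: "'a graph set \<Rightarrow> bool" where
  "perfect_pollyanna \<C> \<longleftrightarrow>
     (\<forall>\<G>. hereditary \<G> \<and> (\<forall>G\<in>\<G>. free_of G triangle \<longrightarrow> colorable G 3) \<longrightarrow>
          (\<forall>G\<in>\<C> \<inter> \<G>. perfectly_divisible G))"

end

(* Every nonempty graph G of the class has a strongly perfect induced subgraph G[A] such that A
   meets all inclusion-maximal cliques; then A and its complement form the required partition.
   Strongly perfect graphs are closed under substitution, so a minimal counterexample G is prime
   (it has no proper homogeneous set with two vertices). It is not 3-colorable, and the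
   non-neighborhood M(v) of every vertex v fails to be strongly perfect, since otherwise A could be
   taken as two color classes plus the isolated vertices, or as {v} together with M(v). A minimal
   subset D of M(v) that is not strongly perfect is prime, connected, co-connected, not bipartite
   and not split; this is all that is ever used of the odd holes and antiholes one might expect
   here, and no form of the strong perfect graph theorem is needed. The key fact is that in a prime
   bull-free graph such a D cannot have a vertex complete to it adjacent to a vertex anticomplete
   to it. Without hammers this forces D to be bipartite as soon as v lies in a triangle; without
   houses either no vertex or every vertex lies in a triangle, and the second option contradicts
   the key fact for a vertex v whose non-neighborhood is connected. Without diamonds G is
   either 3-colorable or the union of two cliques. *)
theory Submission
  imports Defs
begin

text \<open>For perfect divisibility it would suffice that \<open>A\<close> meets the cliques of
  maximum size, but this property is lost under substitution: replacing a vertex by a set changes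
  which cliques are maximum. Inclusion-maximality is stable: a maximal clique that meets the
  inserted set leaves maximal cliques in both factors, so transversals of the factors can be glued.
  The classes of bipartite and split graphs come from the self-complementarity of the bull. For a
  vertex \<open>m\<close> and a prime set \<open>D\<close>, an anticenter of \<open>D\<close>
  adjacent to \<open>m\<close> makes the neighbors of \<open>m\<close> in \<open>D\<close> stable,
  unless \<open>m\<close> is complete to \<open>D\<close>; a center of \<open>D\<close> not adjacent
  to \<open>m\<close> makes the non-neighbors a clique, unless \<open>m\<close> is anticomplete to
  \<open>D\<close>. Both together would make \<open>D\<close> split. The obstacle in the key fact is
  that vertices constant on \<open>D\<close> may be mixed on a larger set, where primality of
  \<open>D\<close> says nothing. The relation \<open>generates\<close> is the part of primality that
  survives enlarging \<open>D\<close>.\<close>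

locale adjacency =
  fixes adj :: "'a \<Rightarrow> 'a \<Rightarrow> bool" (infix "\<sim>" 50)
  assumes adj_commute: "x \<sim> y \<longleftrightarrow> y \<sim> x"
    and adj_irrefl: "\<not> x \<sim> x"
begin

lemma adj_sym: "x \<sim> y \<Longrightarrow> y \<sim> x"
  using adj_commute by blast

section \<open>Vertex sets, modules and forbidden configurations\<close>

definition stable :: "'a set \<Rightarrow> bool" where
  "stable S \<longleftrightarrow> (\<forall>x\<in>S. \<forall>y\<in>S. \<not> x \<sim> y)"

definition complete_set :: "'a set \<Rightarrow> bool" where
  "complete_set S \<longleftrightarrow> (\<forall>x\<in>S. \<forall>y\<in>S. x \<noteq> y \<longrightarrow> x \<sim> y)"

definition maximal_clique :: "'a set \<Rightarrow> 'a set \<Rightarrow> bool" where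
  "maximal_clique V K \<longleftrightarrow> K \<subseteq> V \<and> complete_set K \<and> (\<forall>x\<in>V - K. \<exists>k\<in>K. \<not> x \<sim> k)"

text \<open>The empty set is a maximal clique of \<open>{}\<close>, so \<open>{}\<close> has no transversal.\<close>

definition transversal :: "'a set \<Rightarrow> 'a set \<Rightarrow> bool" where
  "transversal V A \<longleftrightarrow> A \<subseteq> V \<and> (\<forall>K. maximal_clique V K \<longrightarrow> K \<inter> A \<noteq> {})"

text \<open>Strong perfection in the sense of Berge and Duchet. The empty set is exempted because it
  has no transversal.\<close>

definition strongly_perfect :: "'a set \<Rightarrow> bool" where
  "strongly_perfect S \<longleftrightarrow> (\<forall>X\<subseteq>S. X \<noteq> {} \<longrightarrow> (\<exists>I. stable I \<and> transversal X I))"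

definition mixed :: "'a \<Rightarrow> 'a set \<Rightarrow> bool" where
  "mixed u S \<longleftrightarrow> (\<exists>x\<in>S. u \<sim> x) \<and> (\<exists>y\<in>S. \<not> u \<sim> y)"

definition prime_set :: "'a set \<Rightarrow> bool" where
  "prime_set V \<longleftrightarrow> (\<forall>S. S \<subset> V \<longrightarrow> (\<exists>x\<in>S. \<exists>y\<in>S. x \<noteq> y) \<longrightarrow> (\<exists>u\<in>V - S. mixed u S))"

definition bipartite :: "'a set \<Rightarrow> bool" where
  "bipartite S \<longleftrightarrow> (\<exists>P. stable (S \<inter> P) \<and> stable (S - P))"

definition split :: "'a set \<Rightarrow> bool" where
  "split S \<longleftrightarrow> (\<exists>P. stable (S \<inter> P) \<and> complete_set (S - P))"

definition triangle_free :: "'a set \<Rightarrow> bool" where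
  "triangle_free S \<longleftrightarrow> \<not> (\<exists>a\<in>S. \<exists>b\<in>S. \<exists>c\<in>S. a \<sim> b \<and> a \<sim> c \<and> b \<sim> c)"

definition three_colorable :: "'a set \<Rightarrow> bool" where
  "three_colorable S \<longleftrightarrow>
     (\<exists>c :: 'a \<Rightarrow> nat. (\<forall>x\<in>S. c x < 3) \<and> (\<forall>x\<in>S. \<forall>y\<in>S. x \<sim> y \<longrightarrow> c x \<noteq> c y))"

definition non_neighbors :: "'a set \<Rightarrow> 'a \<Rightarrow> 'a set" where
  "non_neighbors V v = {x \<in> V. x \<noteq> v \<and> \<not> v \<sim> x}"

definition coadj :: "'a \<Rightarrow> 'a \<Rightarrow> bool" where
  "coadj x y \<longleftrightarrow> x \<noteq> y \<and> \<not> x \<sim> y"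

lemma coadj_sym: "coadj x y \<Longrightarrow> coadj y x"
  using adj_sym by (auto simp: coadj_def)

text \<open>The triangle is \<open>a b c\<close>, with pendants \<open>d\<close> at \<open>a\<close>
  and \<open>e\<close> at \<open>b\<close>. The prescribed adjacencies and non-adjacencies already
  force five distinct vertices.\<close>

definition bull_free :: "'a set \<Rightarrow> bool" where
  "bull_free V \<longleftrightarrow> (\<forall>a\<in>V. \<forall>b\<in>V. \<forall>c\<in>V. \<forall>d\<in>V. \<forall>e\<in>V.
     a \<sim> b \<longrightarrow> a \<sim> c \<longrightarrow> b \<sim> c \<longrightarrow> a \<sim> d \<longrightarrow> b \<sim> e \<longrightarrow>
     d \<sim> b \<or> d \<sim> c \<or> e \<sim> a \<or> e \<sim> c \<or> d \<sim> e)"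

text \<open>The four-cycle is \<open>p q r s\<close>, and \<open>t\<close> is the roof over the edge \<open>p q\<close>.\<close>

definition house_free :: "'a set \<Rightarrow> bool" where
  "house_free V \<longleftrightarrow> (\<forall>p\<in>V. \<forall>q\<in>V. \<forall>r\<in>V. \<forall>s\<in>V. \<forall>t\<in>V.
     p \<sim> q \<longrightarrow> q \<sim> r \<longrightarrow> r \<sim> s \<longrightarrow> s \<sim> p \<longrightarrow> t \<sim> p \<longrightarrow> t \<sim> q \<longrightarrow>
     p \<sim> r \<or> q \<sim> s \<or> t \<sim> r \<or> t \<sim> s)"

definition hammer_free :: "'a set \<Rightarrow> bool" where
  "hammer_free V \<longleftrightarrow> (\<forall>a\<in>V. \<forall>b\<in>V. \<forall>c\<in>V. \<forall>d\<in>V. \<forall>e\<in>V.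
     a \<sim> b \<longrightarrow> a \<sim> c \<longrightarrow> b \<sim> c \<longrightarrow> c \<sim> d \<longrightarrow> d \<sim> e \<longrightarrow>
     d \<sim> a \<or> d \<sim> b \<or> e \<sim> a \<or> e \<sim> b \<or> e \<sim> c)"

text \<open>Unlike in the patterns above, the adjacencies do not separate \<open>a\<close> from
  \<open>d\<close>, so their distinctness is stated.\<close>

definition diamond_free :: "'a set \<Rightarrow> bool" where
  "diamond_free V \<longleftrightarrow> (\<forall>a\<in>V. \<forall>b\<in>V. \<forall>c\<in>V. \<forall>d\<in>V.
     a \<sim> b \<longrightarrow> a \<sim> c \<longrightarrow> b \<sim> c \<longrightarrow> d \<sim> b \<longrightarrow> d \<sim> c \<longrightarrow> a \<noteq> d \<longrightarrow> a \<sim> d)"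

lemma bull_freeD:
  assumes "bull_free V" "a \<in> V" "b \<in> V" "c \<in> V" "d \<in> V" "e \<in> V"
    and "a \<sim> b" "a \<sim> c" "b \<sim> c" "a \<sim> d" "b \<sim> e"
    and "\<not> d \<sim> b" "\<not> d \<sim> c" "\<not> e \<sim> a" "\<not> e \<sim> c" "\<not> d \<sim> e"
  shows False
  using assms unfolding bull_free_def by blast

lemma house_freeD:
  assumes "house_free V" "p \<in> V" "q \<in> V" "r \<in> V" "s \<in> V" "t \<in> V"
    and "p \<sim> q" "q \<sim> r" "r \<sim> s" "s \<sim> p" "t \<sim> p" "t \<sim> q"
    and "\<not> p \<sim> r" "\<not> q \<sim> s" "\<not> t \<sim> r" "\<not> t \<sim> s"
  shows False
  using assms unfolding house_free_def by blast

lemma hammer_freeD: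
  assumes "hammer_free V" "a \<in> V" "b \<in> V" "c \<in> V" "d \<in> V" "e \<in> V"
    and "a \<sim> b" "a \<sim> c" "b \<sim> c" "c \<sim> d" "d \<sim> e"
    and "\<not> d \<sim> a" "\<not> d \<sim> b" "\<not> e \<sim> a" "\<not> e \<sim> b" "\<not> e \<sim> c"
  shows False
  using assms unfolding hammer_free_def by blast

lemma diamond_freeD:
  assumes "diamond_free V" "a \<in> V" "b \<in> V" "c \<in> V" "d \<in> V"
    and "a \<sim> b" "a \<sim> c" "b \<sim> c" "d \<sim> b" "d \<sim> c" "a \<noteq> d"
  shows "a \<sim> d"
  using assms unfolding diamond_free_def by blast

lemma prime_setD:
  assumes "prime_set V" "S \<subseteq> V" "S \<noteq> V" "\<forall>u\<in>V - S. \<not> mixed u S" "x \<in> S" "y \<in> S"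
  shows "x = y"
  using assms unfolding prime_set_def by blast

subsection \<open>Connectivity\<close>

text \<open>Edge cuts of an arbitrary relation: with \<open>adj\<close> this is connectedness, with
  \<open>coadj\<close> connectedness of the complement, and one theory serves both.\<close>

definition connected_by :: "('a \<Rightarrow> 'a \<Rightarrow> bool) \<Rightarrow> 'a set \<Rightarrow> bool" where
  "connected_by R S \<longleftrightarrow> (\<forall>K\<subseteq>S. K \<noteq> {} \<longrightarrow> K \<noteq> S \<longrightarrow> (\<exists>x\<in>K. \<exists>y\<in>S - K. R x y))"

lemma connected_byD:
  assumes "connected_by R S" "K \<subseteq> S" "K \<noteq> {}" "K \<noteq> S"
  obtains x y where "x \<in> K" "y \<in> S" "y \<notin> K" "R x y"
  using assms unfolding connected_by_def by blast

lemma connected_by_pair: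
  assumes "R x y" "\<And>u v. R u v \<Longrightarrow> R v u"
  shows "connected_by R {x, y}"
  unfolding connected_by_def
proof (intro allI impI)
  fix K assume "K \<subseteq> {x, y}" "K \<noteq> {}" "K \<noteq> {x, y}"
  then have "K = {x} \<and> x \<noteq> y \<or> K = {y} \<and> x \<noteq> y" by blast
  then show "\<exists>u\<in>K. \<exists>v\<in>{x, y} - K. R u v" using assms by blast
qed

lemma connected_by_insert:
  assumes "connected_by R S" "k \<in> S" "R u k" "\<And>u v. R u v \<Longrightarrow> R v u"
  shows "connected_by R (insert u S)"
  unfolding connected_by_def
proof (intro allI impI)
  fix K assume K: "K \<subseteq> insert u S" "K \<noteq> {}" "K \<noteq> insert u S"
  show "\<exists>x\<in>K. \<exists>y\<in>insert u S - K. R x y"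
  proof (cases "K \<inter> S = {} \<or> S \<subseteq> K")
    case True
    then show ?thesis
    proof
      assume "K \<inter> S = {}"
      then show ?thesis using K assms(2,3) by blast
    next
      assume "S \<subseteq> K"
      then show ?thesis using K assms(2,3,4) by blast
    qed
  next
    case False
    then have "K \<inter> S \<subseteq> S" "K \<inter> S \<noteq> {}" "K \<inter> S \<noteq> S" by auto
    then show ?thesis using connected_byD[OF assms(1)] by (metis Diff_iff IntE IntI insertCI)
  qed
qed

lemma component_exists:
  assumes "connected_by R D" "D \<noteq> {}" "D \<subseteq> S" and sym: "\<And>u v. R u v \<Longrightarrow> R v u"
  obtains K where "D \<subseteq> K" "K \<subseteq> S" "connected_by R K"
    "\<forall>u\<in>S - K. \<forall>k\<in>K. \<not> R u k"
proof -
  define F where "F = {L. D \<subseteq> L \<and> L \<subseteq> S \<and> connected_by R L}"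
  obtain d where d: "d \<in> D" using assms(2) by blast
  have con: "connected_by R (\<Union>F)"
    unfolding connected_by_def
  proof (intro allI impI)
    fix K assume K: "K \<subseteq> \<Union>F" "K \<noteq> {}" "K \<noteq> \<Union>F"
    obtain x L where x: "x \<in> K" "x \<in> L" "L \<in> F" using K by blast
    obtain y L' where y: "y \<notin> K" "y \<in> L'" "L' \<in> F" using K by blast
    \<comment> \<open>All members of \<open>F\<close> share \<open>d\<close>, so on whichever side
      of the cut \<open>d\<close> lies, some member reaches both sides.\<close>
    obtain M where M: "M \<in> F" "K \<inter> M \<noteq> {}" "K \<inter> M \<noteq> M"
    proof (cases "d \<in> K")
      case True
      then show ?thesis using that[of L'] y d unfolding F_def by blast
    next
      case False
      then show ?thesis using that[of L] x d unfolding F_def by blast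
    qed
    then have "connected_by R M" unfolding F_def by blast
    then obtain p q where "p \<in> K \<inter> M" "q \<in> M" "q \<notin> K \<inter> M" "R p q"
      using connected_byD[of R M "K \<inter> M"] M by blast
    then show "\<exists>x\<in>K. \<exists>y\<in>\<Union>F - K. R x y" using M by blast
  qed
  have DF: "D \<in> F" unfolding F_def using assms by blast
  show thesis
  proof
    show "D \<subseteq> \<Union>F" using DF by blast
    show "\<Union>F \<subseteq> S" unfolding F_def by blast
    show "connected_by R (\<Union>F)" by (rule con)
    show "\<forall>u\<in>S - \<Union>F. \<forall>k\<in>\<Union>F. \<not> R u k"
    proof (intro ballI notI)
      fix u k assume u: "u \<in> S - \<Union>F" "k \<in> \<Union>F" and "R u k"
      then have "connected_by R (insert u (\<Union>F))"
        using connected_by_insert[OF con] u sym by blast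
      then have "insert u (\<Union>F) \<in> F" using u DF unfolding F_def by blast
      then show False using u by blast
    qed
  qed
qed

lemma mixed_edge:
  assumes "connected_by adj K" "mixed u K"
  obtains x y where "x \<in> K" "y \<in> K" "x \<sim> y" "u \<sim> x" "\<not> u \<sim> y"
proof -
  have "{x \<in> K. u \<sim> x} \<subseteq> K" "{x \<in> K. u \<sim> x} \<noteq> {}" "{x \<in> K. u \<sim> x} \<noteq> K"
    using assms(2) unfolding mixed_def by auto
  then show thesis using connected_byD[OF assms(1)] that by (metis (mono_tags, lifting) mem_Collect_eq)
qed

lemma mixed_coedge:
  assumes "connected_by coadj K" "mixed u K"
  obtains x y where "x \<in> K" "y \<in> K" "x \<noteq> y" "\<not> x \<sim> y" "u \<sim> x" "\<not> u \<sim> y"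
proof -
  have "{x \<in> K. u \<sim> x} \<subseteq> K" "{x \<in> K. u \<sim> x} \<noteq> {}" "{x \<in> K. u \<sim> x} \<noteq> K"
    using assms(2) unfolding mixed_def by auto
  then show thesis using connected_byD[OF assms(1)] that
    by (metis (mono_tags, lifting) mem_Collect_eq coadj_def)
qed

section \<open>Homogeneous sets forced by bull-freeness\<close>

text \<open>\<open>K\<close> is the component of the neighbors of \<open>m\<close> in
  \<open>F\<close> that contains \<open>D\<close>. A vertex \<open>u\<close> of \<open>F - K\<close>
  mixed on \<open>K\<close> is not adjacent to \<open>m\<close>; if it distinguishes an edge
  \<open>x y\<close> of \<open>K\<close>, the triangle \<open>x m y\<close> with pendants
  \<open>u\<close> at \<open>x\<close> and \<open>w\<close> at \<open>m\<close> is a bull.\<close>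

lemma neighbor_module:
  assumes bf: "bull_free V" and V: "m \<in> V" "w \<in> V" "F \<subseteq> V" and mw: "m \<sim> w"
    and anti: "\<forall>x\<in>F. \<not> w \<sim> x"
    and D: "D \<subseteq> F" "\<forall>x\<in>D. m \<sim> x" "connected_by adj D" "D \<noteq> {}"
  obtains K where "D \<subseteq> K" "K \<subseteq> F" "\<forall>x\<in>K. m \<sim> x"
    "\<forall>u\<in>F - K. \<not> mixed u K"
proof -
  have sub: "D \<subseteq> {x \<in> F. m \<sim> x}" using D by blast
  obtain K where K: "D \<subseteq> K" "K \<subseteq> {x \<in> F. m \<sim> x}" "connected_by adj K"
    and sep: "\<forall>u\<in>{x \<in> F. m \<sim> x} - K. \<forall>k\<in>K. \<not> u \<sim> k"
    using component_exists[OF D(3,4) sub adj_sym] .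
  show thesis
  proof (rule that[OF K(1)])
    show "K \<subseteq> F" "\<forall>x\<in>K. m \<sim> x" using K by auto
    show "\<forall>u\<in>F - K. \<not> mixed u K"
    proof (intro ballI notI)
      fix u assume u: "u \<in> F - K" and mx: "mixed u K"
      then have mu: "\<not> m \<sim> u" using sep u unfolding mixed_def by blast
      obtain x y where xy: "x \<in> K" "y \<in> K" "x \<sim> y" "u \<sim> x" "\<not> u \<sim> y"
        using mixed_edge[OF K(3) mx] .
      have "x \<in> V" "y \<in> V" "u \<in> V" "m \<sim> x" "m \<sim> y" "\<not> w \<sim> x" "\<not> w \<sim> y" "\<not> w \<sim> u"
        using xy u K V anti by auto
      then show False
        using bull_freeD[OF bf, of x m y u w] xy mu mw V by (simp add: adj_commute)
    qed
  qed
qed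

text \<open>The complement of \<open>neighbor_module\<close>: the anticenter \<open>w\<close>
  adjacent to \<open>m\<close> becomes a center \<open>c\<close> not adjacent to \<open>m\<close>.
  The bull is now the triangle \<open>c u x\<close> with pendants \<open>y\<close> at
  \<open>c\<close> and \<open>m\<close> at \<open>u\<close>.\<close>

lemma non_neighbor_module:
  assumes bf: "bull_free V" and V: "m \<in> V" "c \<in> V" "F \<subseteq> V" and mc: "\<not> m \<sim> c"
    and compl: "\<forall>x\<in>F. c \<sim> x"
    and D: "D \<subseteq> F" "\<forall>x\<in>D. \<not> m \<sim> x" "connected_by coadj D" "D \<noteq> {}"
  obtains K where "D \<subseteq> K" "K \<subseteq> F" "\<forall>x\<in>K. \<not> m \<sim> x"
    "\<forall>u\<in>F - K. \<not> mixed u K"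
proof -
  have sub: "D \<subseteq> {x \<in> F. \<not> m \<sim> x}" using D by blast
  obtain K where K: "D \<subseteq> K" "K \<subseteq> {x \<in> F. \<not> m \<sim> x}" "connected_by coadj K"
    and sep: "\<forall>u\<in>{x \<in> F. \<not> m \<sim> x} - K. \<forall>k\<in>K. \<not> coadj u k"
    using component_exists[OF D(3,4) sub coadj_sym] .
  show thesis
  proof (rule that[OF K(1)])
    show "K \<subseteq> F" "\<forall>x\<in>K. \<not> m \<sim> x" using K by auto
    show "\<forall>u\<in>F - K. \<not> mixed u K"
    proof (intro ballI notI)
      fix u assume u: "u \<in> F - K" and mx: "mixed u K"
      have mu: "m \<sim> u"
      proof (rule ccontr)
        assume "\<not> m \<sim> u"
        then have "\<forall>k\<in>K. \<not> coadj u k" using sep u by blast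
        then show False using mx u unfolding mixed_def coadj_def by auto
      qed
      obtain x y where xy: "x \<in> K" "y \<in> K" "\<not> x \<sim> y" "u \<sim> x" "\<not> u \<sim> y"
        using mixed_coedge[OF K(3) mx] .
      have "x \<in> V" "y \<in> V" "u \<in> V" "\<not> m \<sim> x" "\<not> m \<sim> y" "c \<sim> x" "c \<sim> y" "c \<sim> u"
        using xy u K V compl by auto
      then show False
        using bull_freeD[OF bf, of c u x y m] xy mu mc V by (simp add: adj_commute)
    qed
  qed
qed

text \<open>An edge among the neighbors of \<open>m\<close> would grow to a homogeneous set
  consisting of neighbors of \<open>m\<close>; it misses \<open>y\<close>, against
  primality.\<close>

lemma stable_neighbors_in_prime:
  assumes bf: "bull_free V" and V: "m \<in> V" "w \<in> V" "D \<subseteq> V" and mw: "m \<sim> w"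
    and anti: "\<forall>x\<in>D. \<not> w \<sim> x"
    and pr: "prime_set D" and nc: "y \<in> D" "\<not> m \<sim> y"
  shows "stable {x \<in> D. m \<sim> x}"
  unfolding stable_def
proof (intro ballI notI)
  fix p q assume pq: "p \<in> {x \<in> D. m \<sim> x}" "q \<in> {x \<in> D. m \<sim> x}" "p \<sim> q"
  have "connected_by adj {p, q}" using connected_by_pair[of adj] pq adj_sym by blast
  then obtain K where K: "{p, q} \<subseteq> K" "K \<subseteq> D" "\<forall>x\<in>K. m \<sim> x"
    "\<forall>u\<in>D - K. \<not> mixed u K"
    using neighbor_module[OF bf V mw anti, of "{p, q}"] pq by (auto simp: subset_iff)
  have "p \<noteq> q" using pq adj_irrefl by blast
  moreover have "K \<noteq> D" using K nc by blast
  ultimately show False using prime_setD[OF pr K(2) _ K(4), of p q] K(1) by blast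
qed

lemma complete_non_neighbors_in_prime:
  assumes bf: "bull_free V" and V: "m \<in> V" "c \<in> V" "D \<subseteq> V" and mc: "\<not> m \<sim> c"
    and compl: "\<forall>x\<in>D. c \<sim> x"
    and pr: "prime_set D" and nc: "y \<in> D" "m \<sim> y"
  shows "complete_set {x \<in> D. \<not> m \<sim> x}"
  unfolding complete_set_def
proof (intro ballI impI, rule ccontr)
  fix p q assume pq: "p \<in> {x \<in> D. \<not> m \<sim> x}" "q \<in> {x \<in> D. \<not> m \<sim> x}" "p \<noteq> q" "\<not> p \<sim> q"
  have "coadj p q" using pq unfolding coadj_def by blast
  then have "connected_by coadj {p, q}" using connected_by_pair[of coadj] coadj_sym by blast
  then obtain K where K: "{p, q} \<subseteq> K" "K \<subseteq> D" "\<forall>x\<in>K. \<not> m \<sim> x"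
    "\<forall>u\<in>D - K. \<not> mixed u K"
    using non_neighbor_module[OF bf V mc compl, of "{p, q}"] pq by (auto simp: subset_iff)
  then have "K \<noteq> D" using nc by blast
  then show False using prime_setD[OF pr K(2) _ K(4), of p q] K(1) pq(3) by blast
qed

subsection \<open>Strongly perfect graphs\<close>

text \<open>The isolated vertices of \<open>Q\<close> join \<open>P\<close>. A maximal clique
  avoiding \<open>P\<close> is a single vertex of \<open>Q\<close>, and such a vertex is maximal
  only if it is isolated.\<close>

lemma transversal_bipartite:
  assumes "stable P" "stable Q" "X = P \<union> Q" "X \<noteq> {}"
  shows "\<exists>I. stable I \<and> transversal X I"
proof -
  define I where "I = P \<union> {q \<in> Q. \<forall>x\<in>X. \<not> q \<sim> x}"
  have "stable I"
    unfolding stable_def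
  proof (intro ballI notI)
    fix x y assume "x \<in> I" "y \<in> I" "x \<sim> y"
    moreover have "y \<sim> x" using calculation adj_sym by blast
    ultimately show False using assms unfolding stable_def I_def by blast
  qed
  moreover have "transversal X I"
    unfolding transversal_def
  proof (intro conjI allI impI)
    show "I \<subseteq> X" using assms unfolding I_def by blast
    fix K assume K: "maximal_clique X K"
    show "K \<inter> I \<noteq> {}"
    proof
      assume e: "K \<inter> I = {}"
      then have KQ: "K \<subseteq> Q" using K assms unfolding maximal_clique_def I_def by blast
      have "K \<noteq> {}" using K assms(4) unfolding maximal_clique_def by blast
      then obtain k where k: "k \<in> K" by blast
      then obtain x where x: "x \<in> X" "k \<sim> x" using e KQ unfolding I_def by blast
      have "\<And>l. l \<in> K \<Longrightarrow> l = k"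
        using K KQ k assms(2) unfolding maximal_clique_def complete_set_def stable_def by blast
      then show False
        using K k x adj_irrefl adj_sym unfolding maximal_clique_def by (metis DiffI)
    qed
  qed
  ultimately show ?thesis by blast
qed

lemma strongly_perfect_bipartite:
  assumes "bipartite S"
  shows "strongly_perfect S"
  unfolding strongly_perfect_def
proof (intro allI impI)
  fix X assume X: "X \<subseteq> S" "X \<noteq> {}"
  obtain P where P: "stable (S \<inter> P)" "stable (S - P)" using assms unfolding bipartite_def by blast
  have "stable (X \<inter> P)" "stable (X - P)" using P X unfolding stable_def by blast+
  then show "\<exists>I. stable I \<and> transversal X I" using transversal_bipartite X(2) by blast
qed

lemma strongly_perfect_split:
  assumes "split S"
  shows "strongly_perfect S"
  unfolding strongly_perfect_def
proof (intro allI impI)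
  fix X assume X: "X \<subseteq> S" "X \<noteq> {}"
  obtain P where P: "stable (S \<inter> P)" "complete_set (S - P)" using assms unfolding split_def by blast
  have P': "stable (X \<inter> P)" "complete_set (X - P)"
    using P X unfolding stable_def complete_set_def by blast+
  show "\<exists>I. stable I \<and> transversal X I"
  proof (cases "X - P = {}")
    case True
    then have "X = (X \<inter> P) \<union> {}" by blast
    moreover have "stable {}" by (simp add: stable_def)
    ultimately show ?thesis using transversal_bipartite P' X(2) by metis
  next
    case False
    then obtain k where k: "k \<in> X" "k \<notin> P" by blast
    \<comment> \<open>A maximal clique without \<open>k\<close> contains a non-neighbor of
      \<open>k\<close>. This one cannot lie in the clique part, so it lies in
      \<open>I\<close>.\<close>
    define I where "I = insert k {s \<in> X \<inter> P. \<not> k \<sim> s}"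
    have "stable I"
      unfolding stable_def
    proof (intro ballI notI)
      fix x y assume "x \<in> I" "y \<in> I" "x \<sim> y"
      moreover have "y \<sim> x" using calculation adj_sym by blast
      ultimately show False using P'(1) adj_irrefl unfolding stable_def I_def by blast
    qed
    moreover have "transversal X I"
      unfolding transversal_def
    proof (intro conjI allI impI)
      show "I \<subseteq> X" using k unfolding I_def by blast
      fix K assume K: "maximal_clique X K"
      show "K \<inter> I \<noteq> {}"
      proof
        assume e: "K \<inter> I = {}"
        then have "k \<notin> K" unfolding I_def by blast
        then obtain l where l: "l \<in> K" "\<not> k \<sim> l" using K k unfolding maximal_clique_def by blast
        then have "l \<in> X" "l \<noteq> k" using K \<open>k \<notin> K\<close> unfolding maximal_clique_def by blast+
        have "l \<in> P"
        proof (rule ccontr)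
          assume "l \<notin> P"
          then have "l \<in> X - P" "k \<in> X - P" using k \<open>l \<in> X\<close> by auto
          then show False using P'(2) l(2) \<open>l \<noteq> k\<close> unfolding complete_set_def by metis
        qed
        then show False using e l \<open>l \<in> X\<close> unfolding I_def by blast
      qed
    qed
    ultimately show ?thesis by blast
  qed
qed

lemma strongly_perfect_mono: "strongly_perfect S \<Longrightarrow> T \<subseteq> S \<Longrightarrow> strongly_perfect T"
  unfolding strongly_perfect_def by blast

text \<open>\<open>h\<close> stands for \<open>T\<close> and may lie inside or outside it; strong
  perfection needs this freedom, since a subset of \<open>S \<union> T\<close> can meet
  \<open>T\<close> without containing \<open>h\<close>. A maximal clique disjoint from
  \<open>T\<close> stays maximal in \<open>insert h S\<close>. One that meets \<open>T\<close> has a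
  maximal trace on \<open>T\<close>, and is maximal in \<open>insert h S\<close> after
  \<open>h\<close> replaces this trace.\<close>

lemma transversal_substitution:
  assumes S: "h \<notin> S" "S \<inter> T = {}" "\<forall>s\<in>S. \<forall>t\<in>T. s \<sim> t \<longleftrightarrow> s \<sim> h"
    and A: "transversal (insert h S) A" and B: "transversal T B"
  shows "transversal (S \<union> T) (if h \<in> A then A - {h} \<union> B else A)"
    (is "transversal _ ?A")
  unfolding transversal_def
proof (intro conjI allI impI)
  show "?A \<subseteq> S \<union> T" using A B unfolding transversal_def by auto
  fix K assume K: "maximal_clique (S \<union> T) K"
  then have KD: "K \<subseteq> S \<union> T" "complete_set K" "\<forall>x\<in>S \<union> T - K. \<exists>k\<in>K. \<not> x \<sim> k"
    unfolding maximal_clique_def by auto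
  show "K \<inter> ?A \<noteq> {}"
  proof (cases "K \<inter> T = {}")
    case True
    then have KS: "K \<subseteq> S" using KD by blast
    have "maximal_clique (insert h S) K"
      unfolding maximal_clique_def
    proof (intro conjI ballI)
      show "K \<subseteq> insert h S" "complete_set K" using KS KD by auto
      fix x assume x: "x \<in> insert h S - K"
      show "\<exists>k\<in>K. \<not> x \<sim> k"
      proof (cases "x = h \<and> T \<noteq> {}")
        case True
        then obtain t where t: "t \<in> T" by blast
        then have "t \<notin> K" using KS S(2) by blast
        then obtain k where "k \<in> K" "\<not> t \<sim> k" using KD t by blast
        moreover have "k \<sim> t \<longleftrightarrow> k \<sim> h" using S(3) KS t \<open>k \<in> K\<close> by blast
          ultimately show ?thesis using True adj_sym by blast
      next
        case False
        then show ?thesis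
        proof (cases "x = h")
          case True
          with False have "T = {}" by blast
          \<comment> \<open>An empty \<open>T\<close> has the maximal clique \<open>{}\<close>,
            which \<open>B\<close> cannot meet.\<close>
          then have "maximal_clique T {}" unfolding maximal_clique_def complete_set_def by blast
          then show ?thesis using B unfolding transversal_def by blast
        qed (use KD x in blast)
      qed
    qed
    then have "K \<inter> A \<noteq> {}" using A unfolding transversal_def by blast
    then show ?thesis using KS S(1) by auto
  next
    case False
    then obtain t where t: "t \<in> K" "t \<in> T" by blast
    have cS: "\<forall>x\<in>K \<inter> S. x \<sim> h"
    proof
      fix x assume x: "x \<in> K \<inter> S"
      then have "x \<noteq> t" using t S(2) by blast
      then have "x \<sim> t" using x t KD(2) unfolding complete_set_def by blast
      then show "x \<sim> h" using x t S(3) by blast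
    qed
    have 1: "maximal_clique T (K \<inter> T)"
      unfolding maximal_clique_def
    proof (intro conjI ballI)
      show "K \<inter> T \<subseteq> T" by blast
      show "complete_set (K \<inter> T)" using KD unfolding complete_set_def by blast
      fix x assume x: "x \<in> T - K \<inter> T"
      then obtain k where k: "k \<in> K" "\<not> x \<sim> k" using KD by blast
      have "k \<notin> S"
      proof
        assume "k \<in> S"
        then have "k \<sim> x" using k cS S(3) x by blast
        then show False using k adj_sym by blast
      qed
      then show "\<exists>k\<in>K \<inter> T. \<not> x \<sim> k" using k KD by blast
    qed
    have 2: "maximal_clique (insert h S) (insert h (K \<inter> S))"
      unfolding maximal_clique_def
    proof (intro conjI ballI)
      show "insert h (K \<inter> S) \<subseteq> insert h S" by blast
      show "complete_set (insert h (K \<inter> S))"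
        using KD cS adj_sym unfolding complete_set_def by blast
      fix x assume x: "x \<in> insert h S - insert h (K \<inter> S)"
      then obtain k where k: "k \<in> K" "\<not> x \<sim> k" using KD by blast
      show "\<exists>k\<in>insert h (K \<inter> S). \<not> x \<sim> k"
      proof (cases "k \<in> T")
        case True
        then show ?thesis using k x S(3) by blast
      qed (use k KD in blast)
    qed
    have "K \<inter> T \<inter> B \<noteq> {}" "insert h (K \<inter> S) \<inter> A \<noteq> {}"
      using 1 2 A B unfolding transversal_def by blast+
    then show ?thesis by auto
  qed
qed

lemma stable_substitution:
  assumes S: "h \<notin> S" "\<forall>s\<in>S. \<forall>t\<in>T. s \<sim> t \<longleftrightarrow> s \<sim> h"
    and "stable A" "A \<subseteq> insert h S" "stable B" "B \<subseteq> T"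
  shows "stable (if h \<in> A then A - {h} \<union> B else A)"
proof (cases "h \<in> A")
  case True
  have "stable (A - {h} \<union> B)"
    unfolding stable_def
  proof (intro ballI)
    have *: "\<not> x \<sim> y" if "x \<in> A - {h}" "y \<in> B" for x y
      using that assms True unfolding stable_def by blast
    fix x y assume "x \<in> A - {h} \<union> B" "y \<in> A - {h} \<union> B"
    then show "\<not> x \<sim> y"
      using * assms(3,5) adj_sym unfolding stable_def by blast
  qed
  then show ?thesis using True by simp
qed (use assms in simp)

lemma strongly_perfect_substitution:
  assumes S: "h \<notin> S" "S \<inter> T = {}" "\<forall>s\<in>S. \<forall>t\<in>T. s \<sim> t \<longleftrightarrow> s \<sim> h"
    and A: "strongly_perfect (insert h S)" and B: "strongly_perfect T"
  shows "strongly_perfect (S \<union> T)"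
  unfolding strongly_perfect_def
proof (intro allI impI)
  fix X assume X: "X \<subseteq> S \<union> T" "X \<noteq> {}"
  show "\<exists>I. stable I \<and> transversal X I"
  proof (cases "X \<inter> T = {}")
    case True
    then have "X \<subseteq> insert h S" using X by blast
    then show ?thesis using A X unfolding strongly_perfect_def by blast
  next
    case False
    obtain I where I: "stable I" "transversal (insert h (X \<inter> S)) I"
    proof -
      have "insert h (X \<inter> S) \<subseteq> insert h S" by blast
      then show ?thesis using A that unfolding strongly_perfect_def by blast
    qed
    obtain J where J: "stable J" "transversal (X \<inter> T) J"
      using B False unfolding strongly_perfect_def by (meson inf_le2)
    have hyp: "h \<notin> X \<inter> S" "X \<inter> S \<inter> (X \<inter> T) = {}"
      "\<forall>s\<in>X \<inter> S. \<forall>t\<in>X \<inter> T. s \<sim> t \<longleftrightarrow> s \<sim> h" using S by auto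
    have "I \<subseteq> insert h (X \<inter> S)" "J \<subseteq> X \<inter> T" using I J unfolding transversal_def by auto
    then have "stable (if h \<in> I then I - {h} \<union> J else I)"
      using stable_substitution[OF hyp(1,3) I(1) _ J(1)] by blast
    moreover have "X \<inter> S \<union> X \<inter> T = X" using X by blast
    ultimately show ?thesis
      using transversal_substitution[OF hyp I(2) J(2)] by metis
  qed
qed

section \<open>Minimal obstructions to strong perfection\<close>

lemma homogeneous_iff:
  assumes "\<forall>u\<in>V - S. \<not> mixed u S" "h \<in> S" "s \<in> V - S" "t \<in> S"
  shows "s \<sim> t \<longleftrightarrow> s \<sim> h"
  using assms unfolding mixed_def by blast

text \<open>Take \<open>D\<close> minimal. A nontrivial homogeneous set would exhibit it as a
  substitution of two proper subsets, which are strongly perfect by minimality.\<close>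

lemma minimal_not_strongly_perfect:
  assumes "finite S" "\<not> strongly_perfect S"
  obtains D where "D \<subseteq> S" "prime_set D" "connected_by adj D" "connected_by coadj D"
    "\<not> bipartite D" "\<not> split D"
proof -
  obtain D where D: "D \<subseteq> S" "\<not> strongly_perfect D"
    and min: "\<And>T. T \<subset> D \<Longrightarrow> strongly_perfect T"
  proof -
    let ?F = "{T. T \<subseteq> S \<and> \<not> strongly_perfect T}"
    have "finite ?F" using assms(1) by simp
    moreover have "S \<in> ?F" using assms(2) by simp
    ultimately obtain D where "D \<in> ?F" "\<forall>T\<in>?F. T \<subseteq> D \<longrightarrow> D = T"
      using finite_has_minimal[of ?F] by blast
    then show thesis using that[of D] by blast
  qed
  have nb: "\<not> bipartite D" and ns: "\<not> split D"
    using D strongly_perfect_bipartite strongly_perfect_split by blast+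
  have pr: "prime_set D"
    unfolding prime_set_def
  proof (intro allI impI, rule ccontr)
    fix H assume H: "H \<subset> D" "\<exists>x\<in>H. \<exists>y\<in>H. x \<noteq> y" and "\<not> (\<exists>u\<in>D - H. mixed u H)"
    then have hom: "\<forall>u\<in>D - H. \<not> mixed u H" by blast
    obtain h k where h: "h \<in> H" "k \<in> H" "h \<noteq> k" using H by blast
    have "insert h (D - H) \<subset> D"
    proof
      show "insert h (D - H) \<subseteq> D" using H(1) h(1) by auto
      have "k \<in> D" using H(1) h(2) by auto
      moreover have "k \<notin> insert h (D - H)" using h by simp
      ultimately show "insert h (D - H) \<noteq> D" by metis
    qed
    then have sp: "strongly_perfect (insert h (D - H))" "strongly_perfect H"
      using min H(1) by simp_all
    have iff: "\<forall>s\<in>D - H. \<forall>t\<in>H. s \<sim> t \<longleftrightarrow> s \<sim> h"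
      using homogeneous_iff[OF hom h(1)] by blast
    have "strongly_perfect (D - H \<union> H)"
      by (rule strongly_perfect_substitution[OF _ _ iff sp]) (use h(1) in auto)
    moreover have "D - H \<union> H = D" using H by blast
    ultimately show False using D by simp
  qed
  \<comment> \<open>One argument for both relations: if no \<open>R\<close>-edge leaves
    \<open>K\<close>, then \<open>K\<close> and \<open>D - K\<close> are homogeneous, hence
    singletons by primality, and two vertices form a bipartite graph.\<close>
  have con: "connected_by R D"
    if sym: "\<And>x y. R x y \<Longrightarrow> R y x"
      and mix: "\<And>u K. u \<notin> K \<Longrightarrow> mixed u K \<Longrightarrow> \<exists>k\<in>K. R k u" for R
    unfolding connected_by_def
  proof (intro allI impI, rule ccontr)
    fix K assume K: "K \<subseteq> D" "K \<noteq> {}" "K \<noteq> D" and "\<not> (\<exists>x\<in>K. \<exists>y\<in>D - K. R x y)"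
    then have n: "\<And>x y. x \<in> K \<Longrightarrow> y \<in> D - K \<Longrightarrow> \<not> R x y \<and> \<not> R y x" using sym by blast
    have "\<not> mixed u K" if "u \<in> D - K" for u
      using mix[of u K] n that by blast
    then have 1: "\<And>x y. x \<in> K \<Longrightarrow> y \<in> K \<Longrightarrow> x = y" using prime_setD[OF pr K(1,3)] by blast
    have "\<not> mixed u (D - K)" if "u \<in> D - (D - K)" for u
      using mix[of u "D - K"] n that by blast
    moreover have "D - K \<noteq> D" using K by blast
    ultimately have 2: "\<And>x y. x \<in> D - K \<Longrightarrow> y \<in> D - K \<Longrightarrow> x = y"
      using prime_setD[OF pr, of "D - K"] by blast
    have "stable (D \<inter> K)" "stable (D - K)"
      unfolding stable_def using 1 2 adj_irrefl by blast+
    then show False using nb unfolding bipartite_def by blast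
  qed
  have "connected_by adj D"
    by (rule con) (use adj_sym in \<open>auto simp: mixed_def\<close>)
  moreover have "connected_by coadj D"
  proof (rule con)
    fix u K assume u: "u \<notin> K" "mixed u K"
    then obtain y where "y \<in> K" "\<not> u \<sim> y" unfolding mixed_def by blast
    then show "\<exists>k\<in>K. coadj k u" using u(1) adj_sym unfolding coadj_def by metis
  qed (rule coadj_sym)
  ultimately show thesis using that D(1) pr nb ns by blast
qed

subsection \<open>Centers and anticenters\<close>

text \<open>For \<open>D \<subseteq> E\<close>: the homogeneous sets of \<open>E\<close> that
  contain \<open>D\<close> are just \<open>E\<close> itself. This substitute for primality survives
  the addition of mixed vertices.\<close>

definition generates :: "'a set \<Rightarrow> 'a set \<Rightarrow> bool" where
  "generates D E \<longleftrightarrow> (\<forall>K. D \<subseteq> K \<longrightarrow> K \<subset> E \<longrightarrow> (\<exists>u\<in>E - K. mixed u K))"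

lemma generatesD:
  assumes "generates D E" "D \<subseteq> K" "K \<subseteq> E" "\<forall>u\<in>E - K. \<not> mixed u K"
  shows "K = E"
  using assms unfolding generates_def by blast

text \<open>A set that misses part of \<open>E\<close> is already split by a vertex of
  \<open>E\<close>; a set that contains all of \<open>E\<close> is \<open>E\<close>, which
  \<open>m\<close> splits.\<close>

lemma generates_insert:
  assumes "generates D E" "D \<subseteq> E" "mixed m E"
  shows "generates D (insert m E)"
  unfolding generates_def
proof (intro allI impI)
  fix K assume K: "D \<subseteq> K" "K \<subset> insert m E"
  show "\<exists>u\<in>insert m E - K. mixed u K"
  proof (cases "E \<subseteq> K")
    case True
    then have "m \<notin> K" "mixed m K" using K assms(3) unfolding mixed_def by blast+
    then show ?thesis by blast
  next
    case False
    then have "D \<subseteq> K \<inter> E" "K \<inter> E \<subset> E" using K assms(2) by blast+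
    then obtain u where "u \<in> E - K \<inter> E" "mixed u (K \<inter> E)"
      using assms(1) unfolding generates_def by blast
    then have "u \<in> E - K" "mixed u K" unfolding mixed_def by blast+
    then show ?thesis by blast
  qed
qed

text \<open>If no \<open>R\<close>-edge joins \<open>K\<close> to \<open>E - K\<close>, both are
  homogeneous in \<open>E\<close>. The connected set \<open>D\<close> lies in one of them, which by
  generation is then all of \<open>E\<close>.\<close>

lemma generates_connected_by:
  assumes gen: "generates D E" "D \<subseteq> E" and D: "connected_by R D"
    and sym: "\<And>x y. R x y \<Longrightarrow> R y x"
    and mix: "\<And>u K. u \<notin> K \<Longrightarrow> mixed u K \<Longrightarrow> \<exists>k\<in>K. R k u"
  shows "connected_by R E"
  unfolding connected_by_def
proof (intro allI impI, rule ccontr)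
  fix K assume K: "K \<subseteq> E" "K \<noteq> {}" "K \<noteq> E" and "\<not> (\<exists>x\<in>K. \<exists>y\<in>E - K. R x y)"
  then have n: "\<And>x y. x \<in> K \<Longrightarrow> y \<in> E - K \<Longrightarrow> \<not> R x y \<and> \<not> R y x" using sym by blast
  consider "D \<subseteq> K" | "D \<subseteq> E - K" | "D \<inter> K \<noteq> {}" "D \<inter> K \<noteq> D" using gen(2) by blast
  then show False
  proof cases
    case 1
    have "\<not> mixed u K" if "u \<in> E - K" for u using mix[of u K] n that by blast
    then show False using generatesD[OF gen(1) 1 K(1)] K(3) by blast
  next
    case 2
    have "\<not> mixed u (E - K)" if "u \<in> E - (E - K)" for u using mix[of u "E - K"] n that by blast
    then have "E - K = E" using generatesD[OF gen(1) 2] by blast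
    then show False using K by blast
  next
    case 3
    then obtain x y where "x \<in> D \<inter> K" "y \<in> D" "y \<notin> D \<inter> K" "R x y"
      using connected_byD[OF D, of "D \<inter> K"] by blast
    then show False using n gen(2) by blast
  qed
qed

lemma mixed_adj: "mixed u K \<Longrightarrow> \<exists>k\<in>K. k \<sim> u"
  using adj_sym unfolding mixed_def by blast

lemma mixed_coadj:
  assumes "u \<notin> K" "mixed u K"
  shows "\<exists>k\<in>K. coadj k u"
proof -
  obtain y where "y \<in> K" "\<not> u \<sim> y" using assms(2) unfolding mixed_def by blast
  then show ?thesis using assms(1) adj_sym unfolding coadj_def by metis
qed

lemma maximal_generated:
  assumes "finite V" "D \<subseteq> V" "\<forall>x\<in>D. a \<sim> x" "\<forall>x\<in>D. \<not> v \<sim> x"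
  obtains E where "D \<subseteq> E" "E \<subseteq> V" "generates D E" "\<forall>x\<in>E. a \<sim> x" "\<forall>x\<in>E. \<not> v \<sim> x"
    "\<forall>m\<in>V - E. mixed m E \<longrightarrow> a \<sim> m \<longrightarrow> v \<sim> m"
proof -
  define F where "F = {E. D \<subseteq> E \<and> E \<subseteq> V \<and> generates D E \<and> (\<forall>x\<in>E. a \<sim> x) \<and> (\<forall>x\<in>E. \<not> v \<sim> x)}"
  have "finite F" by (rule finite_subset[of _ "Pow V"]) (use assms(1) in \<open>auto simp: F_def\<close>)
  moreover have "generates D D" unfolding generates_def by blast
  then have "D \<in> F" using assms unfolding F_def by blast
  then have "F \<noteq> {}" by blast
  ultimately obtain E where E: "E \<in> F" and max: "\<forall>L\<in>F. E \<subseteq> L \<longrightarrow> E = L"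
    using finite_has_maximal[of F] by blast
  show thesis
  proof
    show "D \<subseteq> E" "E \<subseteq> V" "generates D E" "\<forall>x\<in>E. a \<sim> x" "\<forall>x\<in>E. \<not> v \<sim> x"
      using E unfolding F_def by auto
    show "\<forall>m\<in>V - E. mixed m E \<longrightarrow> a \<sim> m \<longrightarrow> v \<sim> m"
    proof (intro ballI impI, rule ccontr)
      fix m assume m: "m \<in> V - E" "mixed m E" "a \<sim> m"
      assume "\<not> v \<sim> m"
      then have "insert m E \<in> F"
        using E m generates_insert[of D E m] unfolding F_def by auto
      then have "E = insert m E" using max by blast
      then show False using m(1) by blast
    qed
  qed
qed

text \<open>Outside a maximal \<open>E\<close> generated from \<open>D\<close> with center \<open>a\<close> and anticenter \<open>v\<close>, every vertex is
  mixed on \<open>E\<close> (\<open>M\<close>), a center (\<open>C\<close>) or an anticenter (\<open>A\<close>). The set \<open>A'\<close> contains every anticenter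
  with a neighbor in \<open>M\<close>, is closed under adjacency within \<open>A\<close>, and is complete to \<open>C\<close>, so that
  \<open>E \<union> M \<union> A'\<close> is homogeneous.\<close>

lemma no_adjacent_center_anticenter:
  assumes fin: "finite V" and bf: "bull_free V" and pr: "prime_set V"
    and D: "D \<subseteq> V" "prime_set D" "connected_by adj D" "connected_by coadj D" "\<not> split D"
    and av: "a \<in> V" "v \<in> V" "a \<sim> v" and aD: "\<forall>x\<in>D. a \<sim> x" and vD: "\<forall>x\<in>D. \<not> v \<sim> x"
  shows False
proof -
  obtain d d' where d: "d \<in> D" "d' \<in> D" "d \<noteq> d'"
  proof -
    have "stable (D \<inter> {})" by (simp add: stable_def)
    then have "\<not> complete_set (D - {})" using D(5) unfolding split_def by blast
    then show thesis using that unfolding complete_set_def by blast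
  qed
  obtain E where DE: "D \<subseteq> E" and EV: "E \<subseteq> V" and gen: "generates D E"
    and aE: "\<forall>x\<in>E. a \<sim> x" and vE: "\<forall>x\<in>E. \<not> v \<sim> x"
    and max: "\<forall>m\<in>V - E. mixed m E \<longrightarrow> a \<sim> m \<longrightarrow> v \<sim> m"
    using maximal_generated[OF fin D(1) aD vD] .
  have conE: "connected_by adj E"
    using generates_connected_by[OF gen DE D(3) adj_sym] mixed_adj by blast
  have coconE: "connected_by coadj E"
    using generates_connected_by[OF gen DE D(4) coadj_sym] mixed_coadj by blast
  \<comment> \<open>If \<open>m\<close> is complete or anticomplete to \<open>D\<close>, a module
    lemma yields a homogeneous set of \<open>E\<close> containing \<open>D\<close>, hence
    \<open>E\<close>, on which \<open>m\<close> would not be mixed. Otherwise the neighbors of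
    \<open>m\<close> in \<open>D\<close> are stable and its non-neighbors a clique, so
    \<open>D\<close> is split.\<close>
  have C1: "m \<sim> c"
    if c: "c \<in> V" "\<forall>x\<in>E. c \<sim> x" and w: "w \<in> V" "\<forall>x\<in>E. \<not> w \<sim> x"
      and m: "m \<in> V" "m \<notin> E" "mixed m E" "m \<sim> w" for c w m
  proof (rule ccontr)
    assume mc: "\<not> m \<sim> c"
    consider "\<forall>x\<in>D. m \<sim> x" | "\<forall>x\<in>D. \<not> m \<sim> x" | x y where "x \<in> D" "m \<sim> x" "y \<in> D" "\<not> m \<sim> y"
      by blast
    then show False
    proof cases
      case 1
      obtain K where K: "D \<subseteq> K" "K \<subseteq> E" "\<forall>x\<in>K. m \<sim> x" "\<forall>u\<in>E - K. \<not> mixed u K"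
        using neighbor_module[OF bf m(1) w(1) EV m(4) w(2) DE 1 D(3)] d(1) by blast
      then have "K = E" using generatesD[OF gen K(1,2,4)] by blast
      then show False using K m unfolding mixed_def by blast
    next
      case 2
      obtain K where K: "D \<subseteq> K" "K \<subseteq> E" "\<forall>x\<in>K. \<not> m \<sim> x" "\<forall>u\<in>E - K. \<not> mixed u K"
        using non_neighbor_module[OF bf m(1) c(1) EV mc c(2) DE 2 D(4)] d(1) by blast
      then have "K = E" using generatesD[OF gen K(1,2,4)] by blast
      then show False using K m unfolding mixed_def by blast
    next
      case 3
      have "\<forall>x\<in>D. \<not> w \<sim> x" "\<forall>x\<in>D. c \<sim> x" using c w DE by blast+
      then have "stable {x \<in> D. m \<sim> x}" "complete_set {x \<in> D. \<not> m \<sim> x}"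
        using stable_neighbors_in_prime[OF bf m(1) w(1) D(1) m(4) _ D(2) 3(3,4)]
          complete_non_neighbors_in_prime[OF bf m(1) c(1) D(1) mc _ D(2) 3(1,2)] by blast+
      moreover have "{x \<in> D. m \<sim> x} = D \<inter> {x. m \<sim> x}" "{x \<in> D. \<not> m \<sim> x} = D - {x. m \<sim> x}" by blast+
      ultimately show False using D(5) unfolding split_def by metis
    qed
  qed
  \<comment> \<open>Since \<open>m\<close> is adjacent to \<open>c\<close> by \<open>C1\<close>, a
    nonadjacent pair \<open>x\<close>, \<open>y\<close> of \<open>E\<close> distinguished by
    \<open>m\<close> completes the bull on the triangle \<open>m c x\<close> with pendants
    \<open>w\<close> at \<open>m\<close> and \<open>y\<close> at \<open>c\<close>.\<close>
  have C2: "c \<sim> w"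
    if c: "c \<in> V" "\<forall>x\<in>E. c \<sim> x" and w: "w \<in> V" "\<forall>x\<in>E. \<not> w \<sim> x"
      and m: "m \<in> V" "m \<notin> E" "mixed m E" "m \<sim> w" for c w m
  proof (rule ccontr)
    assume cw: "\<not> c \<sim> w"
    have mc: "m \<sim> c" using C1[OF c w m] .
    obtain x y where xy: "x \<in> E" "y \<in> E" "x \<noteq> y" "\<not> x \<sim> y" "m \<sim> x" "\<not> m \<sim> y"
      using mixed_coedge[OF coconE m(3)] .
    have "x \<in> V" "y \<in> V" "c \<sim> x" "c \<sim> y" "\<not> w \<sim> x" "\<not> w \<sim> y" using xy EV c w by auto
    then show False
      using bull_freeD[OF bf, of m c x w y] xy mc cw m c w by (simp add: adj_commute)
  qed
  define M where "M = {m \<in> V - E. mixed m E}"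
  \<comment> \<open>Each \<open>m\<close> in \<open>M\<close> is adjacent to \<open>a\<close>, by
    \<open>C1\<close> or by a bull on the triangle \<open>a x y\<close>; maximality of
    \<open>E\<close> then makes it adjacent to \<open>v\<close>.\<close>
  have Mv: "m \<sim> v" if m: "m \<in> M" for m
  proof -
    have mm: "m \<in> V" "m \<notin> E" "mixed m E" using m unfolding M_def by auto
    have "a \<sim> m"
    proof (rule ccontr)
      assume am: "\<not> a \<sim> m"
      show False
      proof (cases "m \<sim> v")
        case True
        then show False using C1[OF av(1) aE av(2) vE mm] am adj_sym by blast
      next
        case False
        obtain x y where xy: "x \<in> E" "y \<in> E" "x \<sim> y" "m \<sim> x" "\<not> m \<sim> y"
          using mixed_edge[OF conE mm(3)] .
        have "x \<in> V" "y \<in> V" "a \<sim> x" "a \<sim> y" "\<not> v \<sim> x" "\<not> v \<sim> y" using xy EV aE vE by auto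
        then show False
          using bull_freeD[OF bf, of a x y v m] xy am False av mm by (simp add: adj_commute)
      qed
    qed
    then show ?thesis using max mm adj_sym by blast
  qed
  define C where "C = {c \<in> V. \<forall>x\<in>E. c \<sim> x}"
  define A where "A = {w \<in> V - E. \<forall>x\<in>E. \<not> w \<sim> x}"
  have part: "V \<subseteq> E \<union> M \<union> C \<union> A" unfolding M_def C_def A_def mixed_def by blast
  have MC: "c \<sim> m" if "m \<in> M" "c \<in> C" for m c
    using C1[of c v m] Mv[of m] that av vE adj_sym unfolding M_def C_def by blast
  \<comment> \<open>The clause about \<open>u\<close> looks one edge ahead: it is what makes
    \<open>A'\<close> closed under adjacency in \<open>A\<close>, because a failure two edges away
    creates a bull.\<close>
  define A' where "A' = {w \<in> A. \<forall>c\<in>C. c \<sim> w \<and> (\<forall>u\<in>A. u \<sim> w \<longrightarrow> c \<sim> u)}"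
  have base: "c \<sim> w" if "w \<in> A" "m \<in> M" "w \<sim> m" "c \<in> C" for c w m
    using C2[of c w m] that adj_sym unfolding A_def M_def C_def by blast
  have A'M: "w \<in> A'" if w: "w \<in> A" and m: "m \<in> M" "w \<sim> m" for w m
  proof -
    have "c \<sim> u" if c: "c \<in> C" and u: "u \<in> A" "u \<sim> w" for c u
    proof (rule ccontr)
      assume cu: "\<not> c \<sim> u"
      then have um: "\<not> u \<sim> m" using base[OF u(1) m(1) _ c] by blast
      obtain e where e: "e \<in> E" "\<not> m \<sim> e" using m unfolding M_def mixed_def by blast
      have "\<not> u \<sim> e" "\<not> w \<sim> e" "c \<sim> e" "e \<in> V" "c \<in> V" "w \<in> V" "m \<in> V" "u \<in> V"
        using e u w m c EV unfolding A_def C_def M_def by auto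
      then show False
        using bull_freeD[OF bf, of w c m u e] cu um e u m MC[OF m(1) c] base[OF w m c]
        by (simp add: adj_commute)
    qed
    then show ?thesis using w base[OF w m] unfolding A'_def by blast
  qed
  have A'A: "w' \<in> A'" if w: "w \<in> A'" and w': "w' \<in> A" "w' \<sim> w" for w w'
  proof -
    have wA: "w \<in> A" and P: "\<And>c. c \<in> C \<Longrightarrow> c \<sim> w" "\<And>c u. c \<in> C \<Longrightarrow> u \<in> A \<Longrightarrow> u \<sim> w \<Longrightarrow> c \<sim> u"
      using w unfolding A'_def by blast+
    have "c \<sim> u" if c: "c \<in> C" and u: "u \<in> A" "u \<sim> w'" for c u
    proof (rule ccontr)
      assume cu: "\<not> c \<sim> u"
      then have um: "\<not> u \<sim> w" using P(2)[OF c u(1)] by blast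
      have "d \<in> E" using d DE by blast
      then have "\<not> u \<sim> d" "\<not> w \<sim> d" "\<not> w' \<sim> d" "c \<sim> d" "d \<in> V" "c \<in> V" "w \<in> V" "w' \<in> V" "u \<in> V"
        using u wA w' c EV unfolding A_def C_def by auto
      then show False
        using bull_freeD[OF bf, of w' c w u d] cu um u w' P(1)[OF c] P(2)[OF c w']
        by (simp add: adj_commute)
    qed
    then show ?thesis using w' P unfolding A'_def by blast
  qed
  define X where "X = E \<union> M \<union> A'"
  have "\<not> mixed u X" if u: "u \<in> V - X" for u
  proof -
    consider "u \<in> C" | "u \<in> A - A'" using part u unfolding X_def by blast
    then show ?thesis
    proof cases
      case 1
      then have "\<forall>x\<in>X. u \<sim> x" using MC unfolding X_def C_def A'_def by blast
      then show ?thesis unfolding mixed_def by blast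
    next
      case 2
      have "\<not> u \<sim> x" if x: "x \<in> X" for x
      proof -
        consider "x \<in> E" | "x \<in> M" | "x \<in> A'" using x unfolding X_def by blast
        then show ?thesis using 2 A'M[of u x] A'A[of x u] unfolding A_def by cases blast+
      qed
      then show ?thesis unfolding mixed_def by blast
    qed
  qed
  moreover have "X \<subseteq> V" using EV unfolding X_def M_def A'_def A_def by blast
  moreover have "a \<notin> X"
  proof
    assume "a \<in> X"
    moreover have "a \<notin> E" using aE adj_irrefl by blast
    moreover have "a \<notin> M" using aE unfolding M_def mixed_def by blast
    moreover have "a \<notin> A" using aE d(1) DE unfolding A_def by blast
    ultimately show False unfolding X_def A'_def by blast
  qed
  moreover have "d \<in> X" "d' \<in> X" using d DE unfolding X_def by blast+
  ultimately show False using prime_setD[OF pr, of X d d'] d(3) av(1) by blast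
qed

lemma not_strongly_perfect_non_neighbors:
  assumes "finite V" "\<not> strongly_perfect (non_neighbors V v)"
  obtains D where "D \<subseteq> V" "prime_set D" "connected_by adj D" "connected_by coadj D"
    "\<not> bipartite D" "\<not> split D" "v \<notin> D" "\<forall>x\<in>D. \<not> v \<sim> x"
proof -
  have "finite (non_neighbors V v)" using assms(1) unfolding non_neighbors_def by simp
  then obtain D where D: "D \<subseteq> non_neighbors V v" "prime_set D" "connected_by adj D"
    "connected_by coadj D" "\<not> bipartite D" "\<not> split D"
    using minimal_not_strongly_perfect[OF _ assms(2)] by blast
  have "D \<subseteq> V" "v \<notin> D" "\<forall>x\<in>D. \<not> v \<sim> x" using D(1) unfolding non_neighbors_def by auto
  then show thesis using that D(2-) by blast
qed

lemma not_bipartite_nonempty: "\<not> bipartite D \<Longrightarrow> D \<noteq> {}"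
  unfolding bipartite_def stable_def by blast

subsection \<open>Hammer-free graphs\<close>

text \<open>Let \<open>K\<close> be a component with an edge among the vertices far from the
  triangle. A vertex \<open>u\<close> mixed on \<open>K\<close> has a neighbor in the triangle and
  distinguishes an edge \<open>k l\<close> of \<open>K\<close>. If it sees one vertex of the
  triangle, a hammer runs from the triangle through \<open>u\<close> to \<open>k\<close>; if it sees
  two of them, they form with \<open>u\<close> the triangle of a hammer with path
  \<open>u k l\<close>. So \<open>K\<close> would be homogeneous.\<close>

lemma stable_far_from_triangle:
  assumes hf: "hammer_free V" and pr: "prime_set V"
    and T: "a \<in> V" "b \<in> V" "c \<in> V" "a \<sim> b" "a \<sim> c" "b \<sim> c"
  shows "stable {x \<in> V. \<not> x \<sim> a \<and> \<not> x \<sim> b \<and> \<not> x \<sim> c}"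
  unfolding stable_def
proof (intro ballI notI)
  define Z where "Z = {x \<in> V. \<not> x \<sim> a \<and> \<not> x \<sim> b \<and> \<not> x \<sim> c}"
  fix x y assume "x \<in> {x \<in> V. \<not> x \<sim> a \<and> \<not> x \<sim> b \<and> \<not> x \<sim> c}"
    "y \<in> {x \<in> V. \<not> x \<sim> a \<and> \<not> x \<sim> b \<and> \<not> x \<sim> c}" and xy: "x \<sim> y"
  then have "{x, y} \<subseteq> Z" unfolding Z_def by blast
  moreover have "connected_by adj {x, y}" using connected_by_pair[of adj] xy adj_sym by blast
  ultimately obtain K where K: "{x, y} \<subseteq> K" "K \<subseteq> Z" "connected_by adj K"
    and sep: "\<forall>u\<in>Z - K. \<forall>k\<in>K. \<not> u \<sim> k"
    using component_exists[of adj "{x, y}" Z] adj_sym by blast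
  have "\<not> mixed u K" if u: "u \<in> V - K" for u
  proof
    assume mx: "mixed u K"
    have uZ: "u \<notin> Z" using u sep mx unfolding mixed_def by blast
    obtain k l where kl: "k \<in> K" "l \<in> K" "k \<sim> l" "u \<sim> k" "\<not> u \<sim> l"
      using mixed_edge[OF K(3) mx] .
    have Z: "k \<in> V" "l \<in> V" "\<not> k \<sim> a" "\<not> k \<sim> b" "\<not> k \<sim> c" "\<not> l \<sim> a" "\<not> l \<sim> b" "\<not> l \<sim> c"
      using kl K unfolding Z_def by auto
    have one: False
      if "p \<in> V" "q \<in> V" "r \<in> V" "p \<sim> q" "p \<sim> r" "q \<sim> r" "u \<sim> r" "\<not> u \<sim> p" "\<not> u \<sim> q"
        "\<not> k \<sim> p" "\<not> k \<sim> q" "\<not> k \<sim> r" for p q r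
      using hammer_freeD[OF hf, of p q r u k] that u Z kl by (simp add: adj_commute)
    have two: False
      if "p \<in> V" "q \<in> V" "p \<sim> q" "u \<sim> p" "u \<sim> q"
        "\<not> k \<sim> p" "\<not> k \<sim> q" "\<not> l \<sim> p" "\<not> l \<sim> q" for p q
      using hammer_freeD[OF hf, of p q u k l] that u Z kl by (simp add: adj_commute)
    have "u \<sim> a \<or> u \<sim> b \<or> u \<sim> c" using uZ u unfolding Z_def by blast
    then show False
      using one[of b c a] one[of a c b] one[of a b c] two[of a b] two[of a c] two[of b c] T Z adj_sym
      by metis
  qed
  moreover have "K \<subseteq> V" "a \<notin> K" using K T adj_sym unfolding Z_def by blast+
  ultimately show False using prime_setD[OF pr, of K x y] K(1) T(1) xy adj_irrefl by blast
qed

lemma strongly_perfect_non_neighbors_hammer_free: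
  assumes fin: "finite V" and bf: "bull_free V" and hf: "hammer_free V" and pr: "prime_set V"
    and T: "v \<in> V" "a \<in> V" "b \<in> V" "v \<sim> a" "v \<sim> b" "a \<sim> b"
  shows "strongly_perfect (non_neighbors V v)"
proof (rule ccontr)
  assume "\<not> strongly_perfect (non_neighbors V v)"
  then obtain D where D: "D \<subseteq> V" "prime_set D" "connected_by adj D" "connected_by coadj D"
    "\<not> bipartite D" "\<not> split D" "v \<notin> D" "\<forall>x\<in>D. \<not> v \<sim> x"
    using not_strongly_perfect_non_neighbors[OF fin] by blast
  have st: "stable {x \<in> D. m \<sim> x}" if m: "m \<in> V" "v \<sim> m" for m
  proof -
    have mv: "m \<sim> v" using m adj_sym by blast
    \<comment> \<open>By the key fact a neighbor of the anticenter \<open>v\<close> is not complete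
      to \<open>D\<close>; this provides the non-neighbor required for stability.\<close>
    obtain y where y: "y \<in> D" "\<not> m \<sim> y"
      using no_adjacent_center_anticenter[OF fin bf pr D(1-4,6) m(1) T(1) mv _ D(8)] by blast
    show ?thesis using stable_neighbors_in_prime[OF bf m(1) T(1) D(1) mv D(8,2) y] .
  qed
  have sa: "stable {x \<in> D. a \<sim> x}" and sb: "stable {x \<in> D. b \<sim> x}" using st T by blast+
  have far: "stable {x \<in> V. \<not> x \<sim> v \<and> \<not> x \<sim> a \<and> \<not> x \<sim> b}"
    using stable_far_from_triangle[OF hf pr T] .
  have ex: "\<not> x \<sim> y"
    if "p \<in> V" "q \<in> V" "v \<sim> p" "v \<sim> q" "p \<sim> q" and xy: "x \<in> D" "y \<in> D" "p \<sim> x" "\<not> q \<sim> x" "\<not> p \<sim> y" "\<not> q \<sim> y"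
    for p q x y
  proof
    assume "x \<sim> y"
    moreover have "x \<in> V" "y \<in> V" "\<not> v \<sim> x" "\<not> v \<sim> y" using xy D(1,8) by blast+
    ultimately show False
      using hammer_freeD[OF hf, of v q p x y] that T(1) by (simp add: adj_commute)
  qed
  \<comment> \<open>Adjacency to \<open>a\<close> gives the bipartition. An edge of \<open>D\<close>
    without neighbors of \<open>a\<close> has two, one or no ends adjacent to \<open>b\<close>,
    excluded by \<open>sb\<close>, by a hammer on the triangle \<open>v a b\<close>, and by
    \<open>far\<close>.\<close>
  define P where "P = {x. a \<sim> x}"
  have "stable (D \<inter> P)" using sa unfolding P_def stable_def by blast
  moreover have "stable (D - P)"
    unfolding stable_def
  proof (intro ballI notI)
    fix x y assume xy: "x \<in> D - P" "y \<in> D - P" "x \<sim> y"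
    then have nv: "x \<in> V" "y \<in> V" "\<not> v \<sim> x" "\<not> v \<sim> y" "\<not> a \<sim> x" "\<not> a \<sim> y" "y \<sim> x"
      using D(1,8) adj_sym unfolding P_def by blast+
    consider "b \<sim> x" "b \<sim> y" | "b \<sim> x" "\<not> b \<sim> y" | "\<not> b \<sim> x" "b \<sim> y" | "\<not> b \<sim> x" "\<not> b \<sim> y" by blast
    then show False
    proof cases
      case 1
      then show False using sb xy unfolding stable_def by blast
    next
      case 2
      then show False using ex[of b a x y] xy nv T adj_sym by blast
    next
      case 3
      then show False using ex[of b a y x] xy nv T adj_sym by blast
    next
      case 4
      then have "x \<in> {x \<in> V. \<not> x \<sim> v \<and> \<not> x \<sim> a \<and> \<not> x \<sim> b}" "y \<in> {x \<in> V. \<not> x \<sim> v \<and> \<not> x \<sim> a \<and> \<not> x \<sim> b}"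
        using nv adj_sym by blast+
      then show False using far xy(3) unfolding stable_def by blast
    qed
  qed
  ultimately show False using D(5) unfolding bipartite_def by blast
qed

subsection \<open>House-free graphs\<close>

definition in_triangle :: "'a set \<Rightarrow> 'a \<Rightarrow> bool" where
  "in_triangle V x \<longleftrightarrow> x \<in> V \<and> (\<exists>y\<in>V. \<exists>z\<in>V. x \<sim> y \<and> x \<sim> z \<and> y \<sim> z)"

text \<open>A neighbor \<open>n\<close> in no triangle is isolated in the neighborhood of
  \<open>a\<close>, and the component of \<open>b c\<close> there is homogeneous: if a non-neighbor
  \<open>u\<close> of \<open>a\<close> distinguishes an edge \<open>x y\<close> of it, there is a
  house with four-cycle \<open>a x u n\<close> and roof \<open>y\<close>, or, if \<open>n\<close>
  and \<open>u\<close> are nonadjacent, a bull on the triangle \<open>a x y\<close>.\<close>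

lemma in_triangle_neighbor:
  assumes bf: "bull_free V" and hf: "house_free V" and pr: "prime_set V"
    and a: "in_triangle V a" and n: "n \<in> V" "a \<sim> n"
  shows "in_triangle V n"
proof (rule ccontr)
  assume nt: "\<not> in_triangle V n"
  obtain b c where T: "a \<in> V" "b \<in> V" "c \<in> V" "a \<sim> b" "a \<sim> c" "b \<sim> c"
    using a unfolding in_triangle_def by blast
  define N where "N = {x \<in> V. a \<sim> x} - {n}"
  have nN: "\<not> n \<sim> x" if x: "x \<in> V" "a \<sim> x" for x
  proof
    assume nx: "n \<sim> x"
    have "n \<sim> a" using n(2) adj_sym by blast
    then have "in_triangle V n" unfolding in_triangle_def using n(1) T(1) x nx by blast
    then show False using nt by blast
  qed
  have "b \<noteq> n" "c \<noteq> n" using nN[of c] nN[of b] T adj_sym by blast+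
  then have "{b, c} \<subseteq> N" using T unfolding N_def by blast
  moreover have "connected_by adj {b, c}" using connected_by_pair[of adj] T(6) adj_sym by blast
  ultimately obtain K where K: "{b, c} \<subseteq> K" "K \<subseteq> N" "connected_by adj K"
    and sep: "\<forall>u\<in>N - K. \<forall>k\<in>K. \<not> u \<sim> k"
    using component_exists[of adj "{b, c}" N] adj_sym by blast
  have "\<not> mixed u K" if u: "u \<in> V - K" for u
  proof
    assume mx: "mixed u K"
    have "u \<noteq> n" using mx nN K(2) unfolding mixed_def N_def by blast
    then have au: "\<not> a \<sim> u" using mx u sep unfolding mixed_def N_def by blast
    obtain x y where xy: "x \<in> K" "y \<in> K" "x \<sim> y" "u \<sim> x" "\<not> u \<sim> y"
      using mixed_edge[OF K(3) mx] .
    have *: "x \<in> V" "y \<in> V" "a \<sim> x" "a \<sim> y" using xy K(2) unfolding N_def by auto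
    then have **: "\<not> n \<sim> x" "\<not> n \<sim> y" using nN by blast+
    show False
    proof (cases "n \<sim> u")
      case True
      then show False
        using house_freeD[OF hf, of a x u n y] * ** xy u au n T by (simp add: adj_commute)
    next
      case False
      then show False
        using bull_freeD[OF bf, of a x y n u] * ** xy u au n T by (simp add: adj_commute)
    qed
  qed
  moreover have "K \<subseteq> V" using K(2) unfolding N_def by blast
  moreover have "a \<notin> K" using K(2) adj_irrefl unfolding N_def by blast
  ultimately show False using prime_setD[OF pr, of K b c] K(1) T(1,6) adj_irrefl by blast
qed

text \<open>The vertices lying in triangles are closed under taking neighbors, so they form a
  homogeneous set.\<close>

lemma all_in_triangle:
  assumes bf: "bull_free V" and hf: "house_free V" and pr: "prime_set V"
    and tf: "\<not> triangle_free V" and x: "x \<in> V"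
  shows "in_triangle V x"
proof (rule ccontr)
  assume nx: "\<not> in_triangle V x"
  define T where "T = {y. in_triangle V y}"
  obtain a b c where t: "a \<in> V" "b \<in> V" "c \<in> V" "a \<sim> b" "a \<sim> c" "b \<sim> c"
    using tf unfolding triangle_free_def by blast
  have s: "b \<sim> a" using t adj_sym by blast
  have "in_triangle V a" "in_triangle V b" unfolding in_triangle_def using t s by blast+
  then have "a \<in> T" "b \<in> T" unfolding T_def by blast+
  moreover have "T \<subseteq> V" unfolding T_def in_triangle_def by blast
  moreover have "x \<notin> T" using nx unfolding T_def by blast
  moreover have "\<forall>u\<in>V - T. \<not> mixed u T"
  proof (intro ballI notI)
    fix u assume u: "u \<in> V - T" "mixed u T"
    then obtain y where "y \<in> T" "u \<sim> y" unfolding mixed_def by blast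
    then have "in_triangle V u"
      using in_triangle_neighbor[OF bf hf pr, of y u] u adj_sym unfolding T_def by blast
    then show False using u unfolding T_def by blast
  qed
  ultimately have "a = b" using prime_setD[OF pr, of T a b] x by blast
  then show False using t adj_irrefl by blast
qed

text \<open>In a maximal connected \<open>E\<close> with an anticenter outside, a further vertex
  with a neighbor in \<open>E\<close> is adjacent to all anticenters, or it could be added. So the
  anticenters form a homogeneous set, which is a single vertex \<open>w\<close>.\<close>

lemma maximal_connected_with_anticenter:
  assumes fin: "finite V" and pr: "prime_set V" and D: "D \<subseteq> V" "connected_by adj D" "d \<in> D"
    and v: "v \<in> V" "v \<notin> D" "\<forall>x\<in>D. \<not> v \<sim> x"
  obtains E w where "D \<subseteq> E" "connected_by adj E" "w \<in> V" "E = non_neighbors V w"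
    "\<forall>n\<in>V. w \<sim> n \<longrightarrow> (\<exists>x\<in>E. n \<sim> x)"
proof -
  define F where "F = {E. D \<subseteq> E \<and> E \<subseteq> V \<and> connected_by adj E \<and>
    (\<exists>w\<in>V - E. \<forall>x\<in>E. \<not> w \<sim> x)}"
  have "finite F" by (rule finite_subset[of _ "Pow V"]) (use fin in \<open>auto simp: F_def\<close>)
  moreover have "D \<in> F" using D v unfolding F_def by blast
  then have "F \<noteq> {}" by blast
  ultimately obtain E where E: "E \<in> F" and max: "\<forall>L\<in>F. E \<subseteq> L \<longrightarrow> E = L"
    using finite_has_maximal[of F] by blast
  have DE: "D \<subseteq> E" and EV: "E \<subseteq> V" and con: "connected_by adj E" using E unfolding F_def by auto
  define A where "A = {w \<in> V - E. \<forall>x\<in>E. \<not> w \<sim> x}"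
  obtain w where w: "w \<in> A" using E unfolding F_def A_def by blast
  have compl: "u \<sim> z" if u: "u \<in> V - E - A" and z: "z \<in> A" for u z
  proof (rule ccontr)
    assume uz: "\<not> u \<sim> z"
    obtain x where x: "x \<in> E" "u \<sim> x" using u unfolding A_def by blast
    have "connected_by adj (insert u E)" using connected_by_insert[OF con x] adj_sym by blast
    moreover have "z \<in> V - insert u E" "\<forall>x\<in>insert u E. \<not> z \<sim> x"
      using u z uz adj_sym unfolding A_def by blast+
    ultimately have "insert u E \<in> F" using u DE EV unfolding F_def by blast
    then have "E = insert u E" using max by blast
    then show False using u by blast
  qed
  have "\<not> mixed u A" if u: "u \<in> V - A" for u
  proof (cases "u \<in> E")
    case True
    then have "\<forall>z\<in>A. \<not> u \<sim> z" using adj_sym unfolding A_def by blast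
    then show ?thesis unfolding mixed_def by blast
  next
    case False
    then show ?thesis using compl u unfolding mixed_def by blast
  qed
  moreover have "A \<subseteq> V" "d \<notin> A" "d \<in> V" using D DE unfolding A_def by blast+
  ultimately have single: "z = w" if "z \<in> A" for z
    using prime_setD[OF pr, of A z w] that w by blast
  have nE: "w \<sim> n" if "n \<in> V - E" "n \<noteq> w" for n
    using compl[of n w] single[of n] that w adj_sym by blast
  have "E = non_neighbors V w"
    unfolding non_neighbors_def using nE w EV unfolding A_def by blast
  moreover have "\<exists>x\<in>E. n \<sim> x" if n: "n \<in> V" "w \<sim> n" for n
  proof (rule ccontr)
    assume a: "\<not> ?thesis"
    then have "n \<notin> E" using w n unfolding A_def by blast
    then have "n \<in> A" using a n unfolding A_def by blast
    then show False using single n adj_irrefl by blast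
  qed
  ultimately show thesis using that[of E w] DE con w unfolding A_def by blast
qed

text \<open>After passing from \<open>v0\<close> to a vertex \<open>v\<close> with connected
  non-neighborhood \<open>E\<close> still containing \<open>D\<close>, the aim is a neighbor
  \<open>n\<close> of \<open>v\<close> whose neighbors in \<open>E\<close> are complete to its
  non-neighbors in \<open>E\<close>. Then the co-connected \<open>D\<close> lies on one side, and
  either side contradicts the key fact.\<close>

lemma strongly_perfect_non_neighbors_house_free:
  assumes fin: "finite V" and bf: "bull_free V" and hf: "house_free V" and pr: "prime_set V"
    and tf: "\<not> triangle_free V" and v0: "v0 \<in> V"
  shows "strongly_perfect (non_neighbors V v0)"
proof (rule ccontr)
  assume "\<not> strongly_perfect (non_neighbors V v0)"
  then obtain D where D: "D \<subseteq> V" "prime_set D" "connected_by adj D" "connected_by coadj D"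
    "\<not> bipartite D" "\<not> split D" "v0 \<notin> D" "\<forall>x\<in>D. \<not> v0 \<sim> x"
    using not_strongly_perfect_non_neighbors[OF fin] by blast
  note nocenter = no_adjacent_center_anticenter[OF fin bf pr D(1-4,6)]
  obtain d where d: "d \<in> D" using not_bipartite_nonempty[OF D(5)] by blast
  obtain E v where DE: "D \<subseteq> E" and con: "connected_by adj E" and v: "v \<in> V"
    and E: "E = non_neighbors V v" and nb: "\<forall>n\<in>V. v \<sim> n \<longrightarrow> (\<exists>x\<in>E. n \<sim> x)"
    using maximal_connected_with_anticenter[OF fin pr D(1,3) d v0 D(7,8)] .
  have vE: "\<forall>x\<in>E. x \<in> V \<and> \<not> v \<sim> x \<and> \<not> x \<sim> v"
    using adj_sym unfolding E non_neighbors_def by blast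
  have vD: "\<forall>x\<in>D. \<not> v \<sim> x" using vE DE by blast
  define N where "N = {n \<in> V. v \<sim> n}"
  have N: "n \<in> V" "v \<sim> n" "n \<sim> v" if "n \<in> N" for n
    using that adj_sym unfolding N_def by blast+
  \<comment> \<open>If \<open>u\<close> distinguishes the edge \<open>p q\<close>, the triangle
    \<open>p n q\<close> with pendants \<open>u\<close> at \<open>p\<close> and \<open>v\<close> at
    \<open>n\<close> is a bull.\<close>
  have const: "u \<sim> x \<longleftrightarrow> u \<sim> y"
    if n: "n \<in> N" "n \<sim> x" "n \<sim> y" and xy: "x \<in> E" "y \<in> E" "x \<sim> y" and u: "u \<in> E" "\<not> n \<sim> u"
    for n x y u
  proof -
    have "\<not> (u \<sim> p \<and> \<not> u \<sim> q)" if "p \<in> E" "q \<in> E" "p \<sim> q" "n \<sim> p" "n \<sim> q" for p q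
      using bull_freeD[OF bf, of p n q u v] that n u vE N[OF n(1)] v by (auto simp: adj_commute)
    then show ?thesis using n xy adj_sym by blast
  qed
  \<comment> \<open>Private neighbors \<open>x\<close> of \<open>n\<close> and \<open>y\<close> of
    \<open>m\<close> give a house with four-cycle \<open>n m y x\<close> and roof \<open>v\<close>,
    or, if nonadjacent, a bull on the triangle \<open>n m v\<close>.\<close>
  have nested: "(\<forall>x\<in>E. n \<sim> x \<longrightarrow> m \<sim> x) \<or> (\<forall>x\<in>E. m \<sim> x \<longrightarrow> n \<sim> x)"
    if nm: "n \<in> N" "m \<in> N" "n \<sim> m" for n m
  proof (rule ccontr)
    assume "\<not> ?thesis"
    then obtain x y where xy: "x \<in> E" "n \<sim> x" "\<not> m \<sim> x" "y \<in> E" "m \<sim> y" "\<not> n \<sim> y" by blast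
    note facts = xy nm N[OF nm(1)] N[OF nm(2)] v vE[rule_format, OF xy(1)] vE[rule_format, OF xy(4)]
    show False
    proof (cases "x \<sim> y")
      case True
      then show False using house_freeD[OF hf, of n m y x v] facts by (simp add: adj_commute)
    next
      case False
      then show False using bull_freeD[OF bf, of n m v x y] facts by (simp add: adj_commute)
    qed
  qed
  \<comment> \<open>Since \<open>v\<close> lies in a triangle, \<open>N\<close> contains an edge; if
    adjacent members of \<open>N\<close> always agreed on \<open>E\<close>, the component of this
    edge in \<open>N\<close> would be homogeneous.\<close>
  have "\<exists>n\<in>N. \<exists>m\<in>N. n \<sim> m \<and> (\<exists>x\<in>E. n \<sim> x \<and> \<not> m \<sim> x)"
  proof (rule ccontr)
    assume eq: "\<not> ?thesis"
    obtain p q where pq: "p \<in> N" "q \<in> N" "p \<sim> q"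
      using all_in_triangle[OF bf hf pr tf v] unfolding in_triangle_def N_def by blast
    then have sub: "{p, q} \<subseteq> N" by blast
    have "connected_by adj {p, q}" using connected_by_pair[of adj] pq(3) adj_sym by blast
    then obtain K where K: "{p, q} \<subseteq> K" "K \<subseteq> N" "connected_by adj K"
      and sep: "\<forall>u\<in>N - K. \<forall>k\<in>K. \<not> u \<sim> k"
      using component_exists[OF _ _ sub, of adj] adj_sym by blast
    have "\<not> mixed u K" if u: "u \<in> V - K" for u
    proof
      assume mx: "mixed u K"
      obtain x y where xy: "x \<in> K" "y \<in> K" "x \<sim> y" "u \<sim> x" "\<not> u \<sim> y"
        using mixed_edge[OF K(3) mx] .
      have "u \<noteq> v" using xy K(2) N by blast
      moreover have "u \<notin> N" using sep u xy by blast
      ultimately have "u \<in> E" using u unfolding E non_neighbors_def N_def by blast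
      moreover have "x \<in> N" "y \<in> N" "x \<sim> u" "\<not> y \<sim> u" using xy K(2) adj_sym by blast+
      ultimately show False using eq xy(3) by blast
    qed
    moreover have "K \<subseteq> V" "v \<notin> K" using K(2) adj_irrefl unfolding N_def by blast+
    ultimately show False using prime_setD[OF pr, of K p q] K(1) v pq(3) adj_irrefl by blast
  qed
  then obtain n m x0 where nm: "n \<in> N" "m \<in> N" "n \<sim> m" and x0: "x0 \<in> E" "n \<sim> x0" "\<not> m \<sim> x0"
    by blast
  have mn: "\<forall>x\<in>E. m \<sim> x \<longrightarrow> n \<sim> x" using nested[OF nm] x0 by blast
  obtain y0 where y0: "y0 \<in> E" "m \<sim> y0" using nb N[OF nm(2)] by blast
  \<comment> \<open>Otherwise \<open>n\<close> would be a center of \<open>D\<close> adjacent to its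
    anticenter \<open>v\<close>.\<close>
  obtain r0 where r0: "r0 \<in> E" "\<not> n \<sim> r0"
    using nocenter[OF N(1)[OF nm(1)] v N(3)[OF nm(1)] _ vD] DE by blast
  \<comment> \<open>If \<open>x\<close> and \<open>y\<close> are nonadjacent, there is a house with
    four-cycle \<open>n y z x\<close> and roof \<open>m\<close>, or a bull on the triangle
    \<open>n y m\<close> with pendants \<open>x\<close> and \<open>z\<close>. Then
    \<open>const\<close> carries the adjacency of \<open>z\<close> from \<open>y\<close> to
    \<open>x\<close>.\<close>
  have st: "x \<sim> y \<and> z \<sim> x"
    if x: "x \<in> E" "n \<sim> x" "\<not> m \<sim> x" and y: "y \<in> E" "m \<sim> y" and z: "z \<in> E" "\<not> n \<sim> z" "z \<sim> y"
    for x y z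
  proof -
    have f: "n \<sim> y" "\<not> m \<sim> z" using mn y z by blast+
    note facts = x y z f nm N[OF nm(1)] N[OF nm(2)] vE[rule_format, OF x(1)]
      vE[rule_format, OF y(1)] vE[rule_format, OF z(1)]
    have "x \<sim> y"
    proof (rule ccontr)
      assume xy: "\<not> x \<sim> y"
      show False
      proof (cases "z \<sim> x")
        case True
        then show False using house_freeD[OF hf, of n y z x m] facts xy by (simp add: adj_commute)
      next
        case False
        then show False using bull_freeD[OF bf, of n y m x z] facts xy by (simp add: adj_commute)
      qed
    qed
    then show ?thesis using const[OF nm(1) x(2) f(1) x(1) y(1) _ z(1,2)] z(3) by blast
  qed
  \<comment> \<open>By connectedness an edge \<open>x y\<close> leaves the set \<open>Q\<close> of
    counterexamples. Its outer end is a neighbor of \<open>n\<close> with a suitable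
    \<open>z\<close>, and \<open>const\<close> makes \<open>z\<close> adjacent to \<open>x\<close>
    as well.\<close>
  have nbR: "\<exists>z\<in>E. \<not> n \<sim> z \<and> z \<sim> q" if q: "q \<in> E" "n \<sim> q" for q
  proof (rule ccontr)
    define Q where "Q = {x \<in> E. n \<sim> x \<and> (\<forall>z\<in>E. \<not> n \<sim> z \<longrightarrow> \<not> z \<sim> x)}"
    assume "\<not> ?thesis"
    then have "q \<in> Q" using q unfolding Q_def by blast
    moreover have "Q \<subseteq> E" "r0 \<notin> Q" using r0 unfolding Q_def by blast+
    ultimately obtain x y where xy: "x \<in> Q" "y \<in> E" "y \<notin> Q" "x \<sim> y"
      using connected_byD[OF con, of Q] r0(1) by blast
    have yx: "y \<sim> x" using xy adj_sym by blast
    then have ny: "n \<sim> y" using xy unfolding Q_def by blast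
    then obtain z where z: "z \<in> E" "\<not> n \<sim> z" "z \<sim> y" using xy unfolding Q_def by blast
    have "z \<sim> x" using const[of n x y z] nm(1) ny z xy unfolding Q_def by blast
    then show False using z xy(1) unfolding Q_def by blast
  qed
  have ST: "x \<sim> y" if "x \<in> E" "n \<sim> x" "\<not> m \<sim> x" "y \<in> E" "m \<sim> y" for x y
    using st[of x y] nbR[of y] mn that by blast
  \<comment> \<open>By \<open>ST\<close> the neighbors of \<open>n\<close> in \<open>E\<close>
    contain a complete bipartite graph whose sides are distinguished by \<open>m\<close>. Both sides
    are nonempty, by \<open>x0\<close> and \<open>y0\<close>, so \<open>const\<close> spreads one
    adjacency of \<open>z\<close> to all of them.\<close>
  have Rfull: "z \<sim> x"
    if z: "z \<in> E" "\<not> n \<sim> z" and p: "p \<in> E" "n \<sim> p" "z \<sim> p" and x: "x \<in> E" "n \<sim> x" for z p x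
  proof -
    have *: "z \<sim> p' \<longleftrightarrow> z \<sim> q'"
      if "p' \<in> E" "n \<sim> p'" "\<not> m \<sim> p'" "q' \<in> E" "m \<sim> q'" for p' q'
      using const[OF nm(1) that(2) _ that(1,4) ST[OF that] z] mn that by blast
    have "z \<sim> x0"
    proof (cases "m \<sim> p")
      case True
      then show ?thesis using *[of x0 p] x0 p by blast
    next
      case False
      then show ?thesis using *[of p y0] *[of x0 y0] x0 y0 p by blast
    qed
    then have "z \<sim> y0" using *[of x0 y0] x0 y0 by blast
    show ?thesis
    proof (cases "m \<sim> x")
      case True
      then show ?thesis using *[of x0 x] x0 x \<open>z \<sim> x0\<close> by blast
    next
      case False
      then show ?thesis using *[of x y0] x y0 \<open>z \<sim> y0\<close> by blast
    qed
  qed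
  \<comment> \<open>Otherwise connectedness yields an edge \<open>s z\<close> leaving the set of
    vertices without neighbors among those of \<open>n\<close>. With \<open>z\<close> adjacent to
    \<open>x0\<close> and \<open>y0\<close>, the triangle \<open>y0 z x0\<close> has pendants
    \<open>m\<close> at \<open>y0\<close> and \<open>s\<close> at \<open>z\<close>, a bull.\<close>
  have R: "r \<sim> x" if r: "r \<in> E" "\<not> n \<sim> r" and x: "x \<in> E" "n \<sim> x" for r x
  proof (rule ccontr)
    assume rx: "\<not> r \<sim> x"
    define S where "S = {r \<in> E. \<not> n \<sim> r \<and> (\<forall>x\<in>E. n \<sim> x \<longrightarrow> \<not> r \<sim> x)}"
    have "r \<in> S" using Rfull[OF r _ _ _ x] rx r unfolding S_def by blast
    moreover have "S \<subseteq> E" "x0 \<notin> S" using x0 unfolding S_def by blast+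
    ultimately obtain s z where sz: "s \<in> S" "z \<in> E" "z \<notin> S" "s \<sim> z"
      using connected_byD[OF con, of S] x0(1) by blast
    have nz: "\<not> n \<sim> z" using sz unfolding S_def by blast
    then obtain p where "p \<in> E" "n \<sim> p" "z \<sim> p" using sz unfolding S_def by blast
    then have z: "z \<sim> x0" "z \<sim> y0" using Rfull[OF sz(2) nz] x0 y0 mn by blast+
    have s: "s \<in> E" "\<not> n \<sim> s" "\<not> s \<sim> x0" "\<not> s \<sim> y0" "\<not> m \<sim> s" "\<not> m \<sim> z"
      using sz nz x0 y0 mn unfolding S_def by blast+
    show False
      using bull_freeD[OF bf, of y0 z x0 m s] z s sz x0 y0 ST[OF x0 y0] N[OF nm(2)]
        vE[rule_format, OF x0(1)] vE[rule_format, OF y0(1)] vE[rule_format, OF s(1)]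
        vE[rule_format, OF sz(2)] by (simp add: adj_commute)
  qed
  have "D \<inter> {x. n \<sim> x} = {} \<or> D \<inter> {x. n \<sim> x} = D"
  proof (rule ccontr)
    assume "\<not> ?thesis"
    then obtain x y where "x \<in> D \<inter> {x. n \<sim> x}" "y \<in> D" "y \<notin> D \<inter> {x. n \<sim> x}" "coadj x y"
      using connected_byD[OF D(4), of "D \<inter> {x. n \<sim> x}"] by blast
    moreover have "y \<sim> x" using R[of y x] calculation DE by blast
    ultimately show False using adj_sym unfolding coadj_def by blast
  qed
  then show False
  proof
    assume "D \<inter> {x. n \<sim> x} = {}"
    then have n: "\<forall>x\<in>D. \<not> n \<sim> x" by blast
    then have "\<forall>x\<in>D. x0 \<sim> x" using R[OF _ _ x0(1,2)] DE adj_sym by blast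
    then show False
      using nocenter[OF _ _ _ _ n, of x0] N[OF nm(1)] x0 vE adj_sym by blast
  next
    assume "D \<inter> {x. n \<sim> x} = D"
    then have "\<forall>x\<in>D. n \<sim> x" by blast
    then show False using nocenter[OF N(1)[OF nm(1)] v N(3)[OF nm(1)] _ vD] by blast
  qed
qed

subsection \<open>Diamond-free graphs\<close>

lemma maximal_clique_exists:
  assumes "finite V" "T \<subseteq> V" "complete_set T"
  obtains K where "T \<subseteq> K" "maximal_clique V K"
proof -
  define F where "F = {K. T \<subseteq> K \<and> K \<subseteq> V \<and> complete_set K}"
  have "finite F" by (rule finite_subset[of _ "Pow V"]) (use assms(1) in \<open>auto simp: F_def\<close>)
  moreover have "T \<in> F" using assms unfolding F_def by blast
  then have "F \<noteq> {}" by blast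
  ultimately obtain K where K: "K \<in> F" and max: "\<forall>L\<in>F. K \<subseteq> L \<longrightarrow> K = L"
    using finite_has_maximal[of F] by blast
  have "\<exists>k\<in>K. \<not> x \<sim> k" if x: "x \<in> V - K" for x
  proof (rule ccontr)
    assume "\<not> ?thesis"
    then have "\<forall>k\<in>K. x \<sim> k \<and> k \<sim> x" using adj_sym by blast
    then have "insert x K \<in> F" using K x unfolding F_def complete_set_def by blast
    then have "K = insert x K" using max by blast
    then show False using x by blast
  qed
  then show thesis using that[of K] K unfolding F_def maximal_clique_def by blast
qed

text \<open>Maximality gives a non-neighbor \<open>j\<close> of \<open>p\<close> in
  \<open>K\<close>; two neighbors of \<open>p\<close> in \<open>K\<close> would form a diamond with
  \<open>j\<close> and \<open>p\<close>.\<close>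

lemma maximal_clique_unique_neighbor:
  assumes df: "diamond_free V" and K: "maximal_clique V K"
    and p: "p \<in> V" "p \<notin> K" "p \<sim> k" "p \<sim> l" "k \<in> K" "l \<in> K"
  shows "k = l"
proof (rule ccontr)
  assume kl: "k \<noteq> l"
  have KV: "K \<subseteq> V" and com: "\<And>x y. x \<in> K \<Longrightarrow> y \<in> K \<Longrightarrow> x \<noteq> y \<Longrightarrow> x \<sim> y"
    using K unfolding maximal_clique_def complete_set_def by blast+
  obtain j where j: "j \<in> K" "\<not> p \<sim> j" using K p unfolding maximal_clique_def by blast
  then have "j \<noteq> k" "j \<noteq> l" "p \<noteq> j" using p by blast+
  moreover have "j \<in> V" "k \<in> V" "l \<in> V" using KV j p by blast+
  ultimately show False
    using diamond_freeD[OF df, of p k l j] com[of k l] com[of j k] com[of j l] kl j p by blast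
qed

text \<open>Nonadjacent \<open>p\<close> and \<open>q\<close> would be the pendants of a bull on the
  triangle \<open>k l j\<close>.\<close>

lemma outer_neighbors_adjacent:
  assumes bf: "bull_free V" and df: "diamond_free V" and K: "maximal_clique V K"
    and jkl: "j \<in> K" "k \<in> K" "l \<in> K" "j \<noteq> k" "j \<noteq> l" "k \<noteq> l"
    and p: "p \<in> V" "p \<notin> K" "p \<sim> k" and q: "q \<in> V" "q \<notin> K" "q \<sim> l"
  shows "p \<sim> q"
proof (rule ccontr)
  assume pq: "\<not> p \<sim> q"
  have KV: "j \<in> V" "k \<in> V" "l \<in> V" using K jkl unfolding maximal_clique_def by blast+
  have "complete_set K" using K unfolding maximal_clique_def by blast
  then have com: "k \<sim> l" "k \<sim> j" "l \<sim> j" using jkl unfolding complete_set_def by metis+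
  have "\<not> p \<sim> l" "\<not> p \<sim> j" "\<not> q \<sim> k" "\<not> q \<sim> j"
    using maximal_clique_unique_neighbor[OF df K] p q jkl by blast+
  then show False
    using bull_freeD[OF bf, of k l j p q] com KV p q pq by (simp add: adj_commute)
qed

text \<open>Both \<open>p\<close> and \<open>p'\<close> are adjacent to the adjacent vertices
  \<open>q\<close> and \<open>r\<close>, so diamond-freeness makes them adjacent to each other. Then
  \<open>k\<close> and \<open>q\<close> are the nonadjacent ends of a diamond over the edge
  \<open>p p'\<close>.\<close>

lemma outer_neighbor_unique:
  assumes bf: "bull_free V" and df: "diamond_free V" and K: "maximal_clique V K"
    and jkl: "j \<in> K" "k \<in> K" "l \<in> K" "j \<noteq> k" "j \<noteq> l" "k \<noteq> l"
    and p: "p \<in> V" "p \<notin> K" "p \<sim> k" and p': "p' \<in> V" "p' \<notin> K" "p' \<sim> k"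
    and q: "q \<in> V" "q \<notin> K" "q \<sim> l" and r: "r \<in> V" "r \<notin> K" "r \<sim> j"
  shows "p = p'"
proof (rule ccontr)
  assume pp: "p \<noteq> p'"
  have a: "p \<sim> q" "p' \<sim> q" "p \<sim> r" "p' \<sim> r" "q \<sim> r"
    using outer_neighbors_adjacent[OF bf df K] jkl p p' q r by metis+
  have kV: "k \<in> V" using K jkl unfolding maximal_clique_def by blast
  have "\<not> q \<sim> k" using maximal_clique_unique_neighbor[OF df K] q jkl by blast
  moreover have "k \<noteq> q" using jkl q by blast
  moreover have "p \<sim> p'"
    using diamond_freeD[OF df, of p q r p'] a p p' q r pp by blast
  moreover have "k \<sim> p" "k \<sim> p'" using p p' adj_sym by blast+
  ultimately show False
    using diamond_freeD[OF df, of k p p' q] a p p' q kV adj_sym by blast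
qed

text \<open>The outer neighbors of \<open>K\<close> form a clique, contained in a maximal clique
  \<open>L\<close>. Their union is homogeneous, hence all of \<open>V\<close>, so the non-neighbors
  of \<open>k1\<close> lie in the clique \<open>L\<close>.\<close>

lemma strongly_perfect_non_neighbors_diamond_free:
  assumes fin: "finite V" and bf: "bull_free V" and df: "diamond_free V" and pr: "prime_set V"
    and K: "maximal_clique V K"
    and k: "k1 \<in> K" "k2 \<in> K" "k3 \<in> K" "k1 \<noteq> k2" "k1 \<noteq> k3" "k2 \<noteq> k3"
    and p1: "p1 \<in> V" "p1 \<notin> K" "p1 \<sim> k1" and p2: "p2 \<in> V" "p2 \<notin> K" "p2 \<sim> k2"
    and p3: "p3 \<in> V" "p3 \<notin> K" "p3 \<sim> k3"
  shows "strongly_perfect (non_neighbors V k1)"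
proof -
  have KV: "K \<subseteq> V" and comK: "complete_set K" using K unfolding maximal_clique_def by blast+
  define N where "N = {p \<in> V - K. \<exists>k\<in>K. p \<sim> k}"
  have uniq: "p = p'"
    if "x \<in> K" "p \<in> V" "p \<notin> K" "p \<sim> x" "p' \<in> V" "p' \<notin> K" "p' \<sim> x" for x p p'
  proof -
    consider "x = k1" | "x = k2" | "x \<noteq> k1" "x \<noteq> k2" by blast
    then show ?thesis
    proof cases
      case 1
      then show ?thesis
        using outer_neighbor_unique[OF bf df K, of k3 k1 k2 p p' p2 p3] that k p2 p3 by metis
    next
      case 2
      then show ?thesis
        using outer_neighbor_unique[OF bf df K, of k3 k2 k1 p p' p1 p3] that k p1 p3 by metis
    next
      case 3
      then show ?thesis
        using outer_neighbor_unique[OF bf df K, of k2 x k1 p p' p1 p2] that k p1 p2 by metis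
    qed
  qed
  have third: "\<exists>j\<in>K. j \<noteq> x \<and> j \<noteq> y" for x y using k by metis
  have "complete_set N"
    unfolding complete_set_def
  proof (intro ballI impI)
    fix p q assume pq: "p \<in> N" "q \<in> N" "p \<noteq> q"
    then obtain x y where xy: "x \<in> K" "p \<sim> x" "y \<in> K" "q \<sim> y" unfolding N_def by blast
    have m: "p \<in> V" "p \<notin> K" "q \<in> V" "q \<notin> K" using pq unfolding N_def by auto
    have "x \<noteq> y" using uniq xy m pq(3) by metis
    moreover obtain j where "j \<in> K" "j \<noteq> x" "j \<noteq> y" using third by blast
    ultimately show "p \<sim> q" using outer_neighbors_adjacent[OF bf df K] xy m by metis
  qed
  moreover have "N \<subseteq> V" unfolding N_def by blast
  ultimately obtain L where L: "N \<subseteq> L" "maximal_clique V L"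
    using maximal_clique_exists[OF fin] by blast
  have LV: "L \<subseteq> V" and comL: "\<And>x y. x \<in> L \<Longrightarrow> y \<in> L \<Longrightarrow> x \<noteq> y \<Longrightarrow> x \<sim> y"
    using L unfolding maximal_clique_def complete_set_def by blast+
  have pL: "p1 \<in> L" "p2 \<in> L" "p3 \<in> L" using L p1 p2 p3 k unfolding N_def by blast+
  note one = maximal_clique_unique_neighbor[OF df K]
  have pne: "p1 \<noteq> p2" "p1 \<noteq> p3" "p2 \<noteq> p3" using one p1 p2 p3 k by blast+
  have notL: "x \<notin> L" if "x \<in> K" "p \<in> L" "p \<in> V" "p \<notin> K" "p \<sim> y" "y \<in> K" "x \<noteq> y" for x y p
    using comL[of p x] one[of p x y] that by blast
  have kL: "k1 \<notin> L" "k2 \<notin> L" "k3 \<notin> L"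
    using notL[of k1 p2 k2] notL[of k2 p1 k1] notL[of k3 p1 k1] pL p1 p2 p3 k by metis+
  have "\<not> mixed u (K \<union> L)" if u: "u \<in> V - (K \<union> L)" for u
  proof -
    have nK: "\<not> u \<sim> x" if "x \<in> K" for x
      using u that L(1) unfolding N_def by blast
    \<comment> \<open>Here \<open>L\<close> takes the role of \<open>K\<close>: a vertex
      \<open>y\<close> of \<open>K\<close> is an outer neighbor of \<open>L\<close> at some
      \<open>p\<close> other than \<open>x\<close>, so \<open>u\<close> would be adjacent to
      \<open>y\<close>, against \<open>nK\<close>.\<close>
    have nL: "\<not> u \<sim> x" if x: "x \<in> L" for x
    proof
      assume ux: "u \<sim> x"
      have uV: "u \<in> V" "u \<notin> L" using u by auto
      obtain p y where py: "p \<in> L" "p \<noteq> x" "y \<in> V" "y \<notin> L" "y \<sim> p" "y \<in> K"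
      proof (cases "x = p1")
        case True
        then show ?thesis
          using that[of p2 k2] pL pne kL k KV p2 adj_sym by blast
      next
        case False
        then show ?thesis
          using that[of p1 k1] pL pne kL k KV p1 adj_sym by blast
      qed
      obtain j where j: "j \<in> L" "j \<noteq> x" "j \<noteq> p" using pL pne by metis
      have "u \<sim> y"
        using outer_neighbors_adjacent[OF bf df L(2) j(1) x py(1) j(2,3) _ uV ux py(3,4,5)] py(2)
        by blast
      then show False using nK py by blast
    qed
    show ?thesis using nK nL unfolding mixed_def by blast
  qed
  then have "K \<union> L = V"
    using prime_setD[OF pr, of "K \<union> L" k1 k2] k KV LV by blast
  moreover have "x \<notin> non_neighbors V k1" if "x \<in> K" for x
    using comK k(1) that unfolding non_neighbors_def complete_set_def by auto
  moreover have "non_neighbors V k1 \<subseteq> V" unfolding non_neighbors_def by blast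
  ultimately have "non_neighbors V k1 \<subseteq> L" by blast
  then have "complete_set (non_neighbors V k1 - {})" using comL unfolding complete_set_def by blast
  moreover have "stable (non_neighbors V k1 \<inter> {})" by (simp add: stable_def)
  ultimately show ?thesis using strongly_perfect_split unfolding split_def by blast
qed

text \<open>\<open>W\<close> collects the vertices of degree two that lie in triangles. Deleting
  \<open>W\<close> destroys all triangles. Adjacent members of \<open>W\<close> would be twins, so
  \<open>W\<close> is stable, and each member has only two neighbors to avoid when the coloring is
  extended.\<close>

lemma three_colorable_of_thin_triangles:
  assumes pr: "prime_set V" and col: "\<And>X. X \<subseteq> V \<Longrightarrow> triangle_free X \<Longrightarrow> three_colorable X"
    and thin: "\<And>a b c. a \<in> V \<Longrightarrow> b \<in> V \<Longrightarrow> c \<in> V \<Longrightarrow> a \<sim> b \<Longrightarrow> a \<sim> c \<Longrightarrow> b \<sim> c \<Longrightarrow>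
      \<exists>w\<in>{a, b, c}. \<forall>u\<in>V. w \<sim> u \<longrightarrow> u \<in> {a, b, c}"
  shows "three_colorable V"
proof -
  define ends where "ends w x y \<longleftrightarrow> w \<in> V \<and> x \<in> V \<and> y \<in> V \<and> w \<sim> x \<and> w \<sim> y \<and> x \<sim> y \<and>
    (\<forall>u\<in>V. w \<sim> u \<longrightarrow> u = x \<or> u = y)" for w x y
  define W where "W = {w. \<exists>x y. ends w x y}"
  have WV: "W \<subseteq> V" unfolding W_def ends_def by blast
  have W: "w \<in> W" if "w \<in> V" "x \<in> V" "y \<in> V" "w \<sim> x" "w \<sim> y" "x \<sim> y"
    "\<forall>u\<in>V. w \<sim> u \<longrightarrow> u \<in> {w, x, y}" for w x y
  proof -
    have "ends w x y" unfolding ends_def using that adj_irrefl by blast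
    then show ?thesis unfolding W_def by blast
  qed
  have "triangle_free (V - W)"
    unfolding triangle_free_def
  proof
    assume "\<exists>a\<in>V - W. \<exists>b\<in>V - W. \<exists>c\<in>V - W. a \<sim> b \<and> a \<sim> c \<and> b \<sim> c"
    then obtain a b c where t: "a \<in> V - W" "b \<in> V - W" "c \<in> V - W" "a \<sim> b" "a \<sim> c" "b \<sim> c" by blast
    have s: "b \<sim> a" "c \<sim> a" "c \<sim> b" using t adj_sym by blast+
    obtain w where "w \<in> {a, b, c}" "\<forall>u\<in>V. w \<sim> u \<longrightarrow> u \<in> {a, b, c}" using thin[of a b c] t by blast
    then show False using W[of a b c] W[of b a c] W[of c a b] t s by (auto simp: insert_commute)
  qed
  then obtain c :: "'a \<Rightarrow> nat" where c: "\<forall>x\<in>V - W. c x < 3"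
    "\<forall>x\<in>V - W. \<forall>y\<in>V - W. x \<sim> y \<longrightarrow> c x \<noteq> c y"
    using col[of "V - W"] unfolding three_colorable_def by blast
  have stab: "\<not> w \<sim> w'" if w: "w \<in> W" and w': "w' \<in> W" for w w'
  proof
    assume ww: "w \<sim> w'"
    have ww': "w' \<sim> w" using ww adj_sym by blast
    obtain x y where e: "ends w x y" using w unfolding W_def by blast
    then obtain z where z: "z \<in> V" "w \<sim> z" "w' \<sim> z" "\<forall>u\<in>V. w \<sim> u \<longrightarrow> u = w' \<or> u = z"
      using ww w' WV adj_sym unfolding ends_def by (metis subsetD)
    obtain x' y' where e': "ends w' x' y'" using w' unfolding W_def by blast
    have zw: "z \<noteq> w" "z \<noteq> w'" using z adj_irrefl by blast+
    have nb': "u = w \<or> u = z" if "u \<in> V" "w' \<sim> u" for u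
    proof -
      have "w = x' \<or> w = y'" "z = x' \<or> z = y'" "u = x' \<or> u = y'"
        using e' z w WV ww' that unfolding ends_def by blast+
      then show ?thesis using zw by blast
    qed
    have "\<not> mixed u {w, w'}" if u: "u \<in> V - {w, w'}" for u
    proof (cases "u = z")
      case True
      then have "\<forall>x\<in>{w, w'}. u \<sim> x" using z adj_sym by blast
      then show ?thesis unfolding mixed_def by blast
    next
      case False
      then have "\<forall>x\<in>{w, w'}. \<not> u \<sim> x" using u z nb' adj_sym by blast
      then show ?thesis unfolding mixed_def by blast
    qed
    moreover have "{w, w'} \<subseteq> V" "{w, w'} \<noteq> V" using w w' WV z zw by blast+
    ultimately have "w = w'" using prime_setD[OF pr, of "{w, w'}" w w'] by blast
    then show False using ww adj_irrefl by blast
  qed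
  have "\<exists>k<3. \<forall>u\<in>V. w \<sim> u \<longrightarrow> c u \<noteq> k" if w: "w \<in> W" for w
  proof -
    obtain x y where e: "ends w x y" using w unfolding W_def by blast
    have "\<exists>k<3::nat. k \<noteq> i \<and> k \<noteq> j" for i j :: nat
    proof -
      have "{0, 1, 2} - {i, j} \<noteq> {}"
        using card_mono[of "{i, j}" "{0::nat, 1, 2}"] card_insert_le_m1[of 2 "{j}" i] by fastforce
      then obtain k where "k \<in> {0, 1, 2}" "k \<noteq> i" "k \<noteq> j" by blast
      then show ?thesis by force
    qed
    then obtain k where "k < 3" "k \<noteq> c x" "k \<noteq> c y" by blast
    then show ?thesis using e unfolding ends_def by metis
  qed
  then obtain f where f: "\<forall>w\<in>W. f w < 3 \<and> (\<forall>u\<in>V. w \<sim> u \<longrightarrow> c u \<noteq> f w)"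
    using bchoice[of W "\<lambda>w k. k < 3 \<and> (\<forall>u\<in>V. w \<sim> u \<longrightarrow> c u \<noteq> k)"] by blast
  have "(if x \<in> W then f x else c x) \<noteq> (if y \<in> W then f y else c y)"
    if "x \<in> V" "y \<in> V" "x \<sim> y" for x y
    using that stab[of x y] f c adj_sym[OF that(3)] by (smt (verit) DiffI)
  then show ?thesis
    unfolding three_colorable_def using f c
    by (intro exI[of _ "\<lambda>x. if x \<in> W then f x else c x"]) auto
qed

text \<open>Of the vertices of a maximal clique containing a triangle, at most two have outer
  neighbors, or some non-neighborhood would be strongly perfect, and at most one has none, since two
  such vertices are twins. So the clique is the triangle itself, with one vertex closed off.\<close>

lemma diamond_free_cases:
  assumes fin: "finite V" and bf: "bull_free V" and df: "diamond_free V" and pr: "prime_set V"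
    and col: "\<And>X. X \<subseteq> V \<Longrightarrow> triangle_free X \<Longrightarrow> three_colorable X"
  shows "three_colorable V \<or> (\<exists>v\<in>V. strongly_perfect (non_neighbors V v))"
proof (rule disjCI)
  assume none: "\<not> (\<exists>v\<in>V. strongly_perfect (non_neighbors V v))"
  show "three_colorable V"
  proof (rule three_colorable_of_thin_triangles[OF pr col])
    fix a b c assume T: "a \<in> V" "b \<in> V" "c \<in> V" "a \<sim> b" "a \<sim> c" "b \<sim> c"
    have ne: "a \<noteq> b" "a \<noteq> c" "b \<noteq> c" using T adj_irrefl by blast+
    have "complete_set {a, b, c}" using T adj_sym unfolding complete_set_def by blast
    then obtain K where K: "{a, b, c} \<subseteq> K" "maximal_clique V K"
      using maximal_clique_exists[OF fin, of "{a, b, c}"] T by blast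
    have KV: "K \<subseteq> V" and com: "\<And>x y. x \<in> K \<Longrightarrow> y \<in> K \<Longrightarrow> x \<noteq> y \<Longrightarrow> x \<sim> y"
      using K(2) unfolding maximal_clique_def complete_set_def by blast+
    define ext where "ext k \<longleftrightarrow> (\<exists>p\<in>V - K. p \<sim> k)" for k
    have no3: "\<not> (ext x \<and> ext y \<and> ext z)"
      if "x \<in> K" "y \<in> K" "z \<in> K" "x \<noteq> y" "x \<noteq> z" "y \<noteq> z" for x y z
    proof
      assume "ext x \<and> ext y \<and> ext z"
      then obtain p q r where "p \<in> V" "p \<notin> K" "p \<sim> x" "q \<in> V" "q \<notin> K" "q \<sim> y"
        "r \<in> V" "r \<notin> K" "r \<sim> z" unfolding ext_def by blast
      then have "strongly_perfect (non_neighbors V x)"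
        using strongly_perfect_non_neighbors_diamond_free[OF fin bf df pr K(2)] that by metis
      then show False using none KV that(1) by blast
    qed
    have amo: "x = y" if xy: "x \<in> K" "y \<in> K" "\<not> ext x" "\<not> ext y" for x y
    proof -
      have "\<not> mixed u {x, y}" if u: "u \<in> V - {x, y}" for u
      proof (cases "u \<in> K")
        case True
        then have "\<forall>z\<in>{x, y}. u \<sim> z" using com u xy by blast
        then show ?thesis unfolding mixed_def by blast
      next
        case False
        then have "\<forall>z\<in>{x, y}. \<not> u \<sim> z" using u xy unfolding ext_def by blast
        then show ?thesis unfolding mixed_def by blast
      qed
      moreover have "{x, y} \<subseteq> V" using xy KV by blast
      moreover have "{x, y} \<noteq> V" using T ne by blast
      ultimately show ?thesis using prime_setD[OF pr, of "{x, y}" x y] by blast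
    qed
    show "\<exists>w\<in>{a, b, c}. \<forall>u\<in>V. w \<sim> u \<longrightarrow> u \<in> {a, b, c}"
    proof (cases "K = {a, b, c}")
      case True
      have "\<not> ext a \<or> \<not> ext b \<or> \<not> ext c" using no3[of a b c] K ne by blast
      then show ?thesis using True adj_sym unfolding ext_def by blast
    next
      case False
      then obtain d where d: "d \<in> K" "d \<noteq> a" "d \<noteq> b" "d \<noteq> c" using K by blast
      have abc: "a \<in> K" "b \<in> K" "c \<in> K" using K by auto
      show ?thesis
        using no3[of a b c] no3[of a b d] no3[of a c d] no3[of b c d]
          amo[of a b] amo[of a c] amo[of a d] amo[of b c] amo[of b d] amo[of c d] abc d ne by metis
    qed
  qed
qed

subsection \<open>Strongly perfect transversals\<close>

text \<open>Isolated vertices join \<open>A\<close> because each is a maximal clique by itself. A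
  maximal clique avoiding \<open>A\<close> would be a single vertex of color 2 that has a
  neighbor.\<close>

lemma transversal_three_colorable:
  assumes "three_colorable V" "V \<noteq> {}"
  shows "\<exists>A. strongly_perfect A \<and> transversal V A"
proof -
  obtain c :: "'a \<Rightarrow> nat" where c: "\<forall>x\<in>V. c x < 3" "\<forall>x\<in>V. \<forall>y\<in>V. x \<sim> y \<longrightarrow> c x \<noteq> c y"
    using assms(1) unfolding three_colorable_def by blast
  define P where "P = {x. c x = 0 \<or> (\<forall>y\<in>V. \<not> x \<sim> y)}"
  define A where "A = {x \<in> V. c x \<noteq> 2 \<or> (\<forall>y\<in>V. \<not> x \<sim> y)}"
  have "stable (A \<inter> P)"
    unfolding stable_def
  proof (intro ballI notI)
    fix x y assume "x \<in> A \<inter> P" "y \<in> A \<inter> P" and xy: "x \<sim> y"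
    then have "c x = 0" "c y = 0" "x \<in> V" "y \<in> V"
      using adj_sym[OF xy] xy unfolding A_def P_def by blast+
    moreover from this have "c x \<noteq> c y" using c(2) xy by blast
    ultimately show False by simp
  qed
  moreover have "stable (A - P)"
    unfolding stable_def
  proof (intro ballI notI)
    fix x y assume xy: "x \<in> A - P" "y \<in> A - P" "x \<sim> y"
    then have "c x \<noteq> 0" "c y \<noteq> 0" "c x \<noteq> 2" "c y \<noteq> 2" "x \<in> V" "y \<in> V" "c x < 3" "c y < 3"
      using c(1) unfolding A_def P_def by auto
    moreover from this have "c x = c y" by linarith
    ultimately show False using c(2) xy(3) by blast
  qed
  ultimately have "strongly_perfect A" using strongly_perfect_bipartite unfolding bipartite_def by blast
  moreover have "transversal V A"
    unfolding transversal_def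
  proof (intro conjI allI impI notI)
    show "A \<subseteq> V" unfolding A_def by blast
    fix K assume K: "maximal_clique V K" and KA: "K \<inter> A = {}"
    have KV: "K \<subseteq> V" using K unfolding maximal_clique_def by blast
    have c2: "c x = 2" if "x \<in> K" for x using KA KV that unfolding A_def by blast
    have "K \<noteq> {}" using K assms(2) unfolding maximal_clique_def by blast
    then obtain k where k: "k \<in> K" by blast
    then obtain y where y: "y \<in> V" "k \<sim> y" using KA KV unfolding A_def by blast
    have eq: "l = k" if "l \<in> K" for l
      using K c2[OF that] c2[OF k] c(2) KV that k unfolding maximal_clique_def complete_set_def
      by (metis subsetD)
    then have "y \<notin> K" using y adj_irrefl by blast
    then obtain l where "l \<in> K" "\<not> y \<sim> l" using K y unfolding maximal_clique_def by blast
    then show False using eq y adj_sym by blast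
  qed
  ultimately show ?thesis by blast
qed

lemma transversal_non_neighbors:
  assumes sp: "strongly_perfect (non_neighbors V v)" and v: "v \<in> V"
  shows "\<exists>A. strongly_perfect A \<and> transversal V A"
proof -
  define M where "M = non_neighbors V v"
  have vM: "v \<notin> M" "\<And>x. x \<in> M \<Longrightarrow> \<not> v \<sim> x \<and> \<not> x \<sim> v"
    using adj_sym unfolding M_def non_neighbors_def by blast+
  have "strongly_perfect (insert v M)"
    unfolding strongly_perfect_def
  proof (intro allI impI)
    fix X assume X: "X \<subseteq> insert v M" "X \<noteq> {}"
    show "\<exists>I. stable I \<and> transversal X I"
    \<comment> \<open>\<open>X = {v}\<close> is treated apart because removing \<open>v\<close>
      would leave the empty set, which has no transversal.\<close>
    proof (cases "v \<in> X \<and> X \<noteq> {v}")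
      case True
      then have "X - {v} \<subseteq> M" "X - {v} \<noteq> {}" using X by blast+
      then obtain I where I: "stable I" "transversal (X - {v}) I"
        using sp unfolding strongly_perfect_def M_def by blast
      then have IM: "I \<subseteq> M" using X unfolding transversal_def by blast
      have "stable (insert v I)" using I(1) IM vM adj_irrefl unfolding stable_def by blast
      moreover have "transversal X (insert v I)"
        unfolding transversal_def
      proof (intro conjI allI impI notI)
        show "insert v I \<subseteq> X" using I True unfolding transversal_def by blast
        fix K assume K: "maximal_clique X K" and e: "K \<inter> insert v I = {}"
        then have "maximal_clique (X - {v}) K" unfolding maximal_clique_def by blast
        then show False using I(2) e unfolding transversal_def by blast
      qed
      ultimately show ?thesis by blast
    next
      case False
      show ?thesis
      proof (cases "v \<in> X")
        case True
        then have "X = {v} \<union> {}" using False by blast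
        moreover have "stable {v}" "stable {}" using adj_irrefl unfolding stable_def by blast+
        ultimately show ?thesis using transversal_bipartite[of "{v}" "{}" X] X by blast
      next
        case False
        then have "X \<subseteq> M" using X by blast
        then show ?thesis using sp X unfolding strongly_perfect_def M_def by blast
      qed
    qed
  qed
  moreover have "transversal V (insert v M)"
    unfolding transversal_def
  proof (intro conjI allI impI notI)
    show "insert v M \<subseteq> V" using v unfolding M_def non_neighbors_def by blast
    fix K assume K: "maximal_clique V K" and e: "K \<inter> insert v M = {}"
    then have "v \<notin> K" by blast
    then obtain k where "k \<in> K" "\<not> v \<sim> k" using K v unfolding maximal_clique_def by blast
    moreover from this have "k \<in> M"
      using K \<open>v \<notin> K\<close> unfolding M_def non_neighbors_def maximal_clique_def by blast
    ultimately show False using e by blast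
  qed
  ultimately show ?thesis by blast
qed

section \<open>Reduction to prime sets and existence of transversals\<close>

text \<open>Induction on size: contract a homogeneous \<open>S\<close> to one vertex
  \<open>h\<close> and glue the sets for the quotient and for \<open>S\<close>. If the quotient's
  set avoids \<open>h\<close>, it already works unchanged.\<close>

lemma transversal_reduction_to_prime:
  assumes hered: "\<And>V U. P V \<Longrightarrow> U \<subseteq> V \<Longrightarrow> P U"
    and prime: "\<And>V. finite V \<Longrightarrow> V \<noteq> {} \<Longrightarrow> P V \<Longrightarrow> prime_set V \<Longrightarrow>
      \<exists>A. strongly_perfect A \<and> transversal V A"
    and V: "finite V" "V \<noteq> {}" "P V"
  shows "\<exists>A. strongly_perfect A \<and> transversal V A"
  using V
proof (induction "card V" arbitrary: V rule: less_induct)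
  case less
  show ?case
  proof (cases "prime_set V")
    case True
    then show ?thesis using prime less.prems by blast
  next
    case False
    then obtain S h k where S: "S \<subset> V" and hk: "h \<in> S" "k \<in> S" "h \<noteq> k"
      and hom: "\<forall>u\<in>V - S. \<not> mixed u S"
      unfolding prime_set_def by blast
    have sub: "insert h (V - S) \<subset> V"
    proof
      show "insert h (V - S) \<subseteq> V" using S hk by auto
      have "k \<in> V" "k \<notin> insert h (V - S)" using S hk by auto
      then show "insert h (V - S) \<noteq> V" by metis
    qed
    have ih: "\<exists>A. strongly_perfect A \<and> transversal U A" if U: "U \<subset> V" "U \<noteq> {}" for U
    proof (rule less.hyps)
      show "card U < card V" using psubset_card_mono less.prems(1) U(1) by blast
      show "finite U" using finite_subset less.prems(1) U(1) by blast
      show "P U" using hered[OF less.prems(3)] U(1) by blast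
    qed (rule U(2))
    have "S \<noteq> {}" using hk by blast
    then obtain A B where A: "strongly_perfect A" "transversal (insert h (V - S)) A"
      and B: "strongly_perfect B" "transversal S B"
      using ih[OF sub] ih[OF S] by blast
    have iff: "\<forall>s\<in>V - S. \<forall>t\<in>S. s \<sim> t \<longleftrightarrow> s \<sim> h" using homogeneous_iff[OF hom hk(1)] by blast
    have "h \<notin> V - S" "(V - S) \<inter> S = {}" using hk by auto
    from transversal_substitution[OF this iff A(2) B(2)]
    have tr: "transversal V (if h \<in> A then A - {h} \<union> B else A)" using S by (simp add: Un_absorb2)
    show ?thesis
    proof (cases "h \<in> A")
      case True
      have AB: "A \<subseteq> insert h (V - S)" "B \<subseteq> S" using A B unfolding transversal_def by blast+
      have "strongly_perfect (A - {h} \<union> B)"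
      proof (rule strongly_perfect_substitution)
        show "strongly_perfect (insert h (A - {h}))" using A(1) True by (simp add: insert_absorb)
        show "strongly_perfect B" by (rule B(1))
        show "h \<notin> A - {h}" by blast
        show "(A - {h}) \<inter> B = {}" using AB by blast
        show "\<forall>s\<in>A - {h}. \<forall>t\<in>B. s \<sim> t \<longleftrightarrow> s \<sim> h" using AB iff by blast
      qed
      then show ?thesis using tr True by auto
    next
      case False
      then show ?thesis using tr A(1) by auto
    qed
  qed
qed

lemma bull_free_subset: "bull_free V \<Longrightarrow> U \<subseteq> V \<Longrightarrow> bull_free U"
  unfolding bull_free_def by (meson subsetD)

lemma house_free_subset: "house_free V \<Longrightarrow> U \<subseteq> V \<Longrightarrow> house_free U"
  unfolding house_free_def by (meson subsetD)

lemma hammer_free_subset: "hammer_free V \<Longrightarrow> U \<subseteq> V \<Longrightarrow> hammer_free U"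
  unfolding hammer_free_def by (meson subsetD)

lemma diamond_free_subset: "diamond_free V \<Longrightarrow> U \<subseteq> V \<Longrightarrow> diamond_free U"
  unfolding diamond_free_def by (meson subsetD)

lemma strongly_perfect_transversal_exists:
  assumes V: "finite V" "V \<noteq> {}" and bf: "bull_free V"
    and H: "house_free V \<or> hammer_free V \<or> diamond_free V"
    and col: "\<And>X. X \<subseteq> V \<Longrightarrow> triangle_free X \<Longrightarrow> three_colorable X"
  shows "\<exists>A. strongly_perfect A \<and> transversal V A"
proof -
  \<comment> \<open>The coloring condition is part of \<open>P\<close> because it must pass to
    subsets. It is applied to triangle-free \<open>W\<close> and, without diamonds, to subsets of
    \<open>W\<close>.\<close>
  define P where "P V \<longleftrightarrow> bull_free V \<and> (house_free V \<or> hammer_free V \<or> diamond_free V) \<and>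
    (\<forall>X\<subseteq>V. triangle_free X \<longrightarrow> three_colorable X)" for V
  show ?thesis
  proof (rule transversal_reduction_to_prime[where P = P])
    show "P U" if P: "P W" and U: "U \<subseteq> W" for W U
    proof -
      have "\<forall>X\<subseteq>U. triangle_free X \<longrightarrow> three_colorable X" using P U unfolding P_def by simp
      then show ?thesis
        using P bull_free_subset[OF _ U] house_free_subset[OF _ U] hammer_free_subset[OF _ U]
          diamond_free_subset[OF _ U] unfolding P_def by simp metis
    qed
    show "P V" using bf H col unfolding P_def by simp
    fix W assume W: "finite W" "W \<noteq> {}" "P W" "prime_set W"
    then have bf': "bull_free W" and H': "house_free W \<or> hammer_free W \<or> diamond_free W"
      and col': "\<And>X. X \<subseteq> W \<Longrightarrow> triangle_free X \<Longrightarrow> three_colorable X" unfolding P_def by auto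
    show "\<exists>A. strongly_perfect A \<and> transversal W A"
    proof (cases "triangle_free W")
      case True
      then show ?thesis using col'[of W] transversal_three_colorable W(2) by blast
    next
      case tf: False
      then obtain a b c where T: "a \<in> W" "b \<in> W" "c \<in> W" "a \<sim> b" "a \<sim> c" "b \<sim> c"
        unfolding triangle_free_def by blast
      consider "house_free W" | "hammer_free W" | "diamond_free W" using H' by blast
      then have "three_colorable W \<or> (\<exists>v\<in>W. strongly_perfect (non_neighbors W v))"
      proof cases
        case 1
        then show ?thesis
          using strongly_perfect_non_neighbors_house_free[OF W(1) bf' 1 W(4) tf T(1)] T(1) by blast
      next
        case 2
        then show ?thesis
          using strongly_perfect_non_neighbors_hammer_free[OF W(1) bf' 2 W(4) T] T(1) by blast
      next
        case 3
        then show ?thesis using diamond_free_cases[OF W(1) bf' 3 W(4)] col' by blast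
      qed
      then show ?thesis using transversal_three_colorable transversal_non_neighbors W(2) by blast
    qed
  qed (use V in auto)
qed

end

subsection \<open>Graphs and their adjacency relations\<close>

definition graph_adj :: "'a graph \<Rightarrow> 'a \<Rightarrow> 'a \<Rightarrow> bool" where
  "graph_adj G x y \<longleftrightarrow> {x, y} \<in> edges G"

lemma adjacency_graph_adj:
  assumes "simple_graph G"
  shows "adjacency (graph_adj G)"
proof
  show "graph_adj G x y \<longleftrightarrow> graph_adj G y x" for x y
    unfolding graph_adj_def by (simp add: insert_commute)
  show "\<not> graph_adj G x x" for x
    using assms unfolding graph_adj_def simple_graph_def by fastforce
qed

text \<open>Patterns are embedded by listing their vertices in \<open>G\<close>, whereas
  \<open>graph_iso\<close> maps the induced subgraph to the pattern; hence the inverse of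
  \<open>g\<close>.\<close>

lemma not_free_ofI:
  assumes "inj_on g (verts F)" "g ` verts F \<subseteq> verts G"
    and "\<And>i j. i \<in> verts F \<Longrightarrow> j \<in> verts F \<Longrightarrow> {g i, g j} \<in> edges G \<longleftrightarrow> {i, j} \<in> edges F"
  shows "\<not> free_of G F"
proof -
  let ?f = "the_inv_into (verts F) g"
  have "graph_iso (induced G (g ` verts F)) F"
    unfolding graph_iso_def
  proof (intro exI conjI ballI)
    show "bij_betw ?f (verts (induced G (g ` verts F))) (verts F)"
      using bij_betw_the_inv_into[OF inj_on_imp_bij_betw[OF assms(1)]] by (simp add: induced_def)
    fix u v
    assume "u \<in> verts (induced G (g ` verts F))" "v \<in> verts (induced G (g ` verts F))"
    then obtain i j where "i \<in> verts F" "j \<in> verts F" "u = g i" "v = g j"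
      by (auto simp: induced_def)
    then show "{u, v} \<in> edges (induced G (g ` verts F)) \<longleftrightarrow> {?f u, ?f v} \<in> edges F"
      using assms(3)[of i j] by (simp add: induced_def the_inv_into_f_f[OF assms(1)])
  qed
  then show ?thesis unfolding free_of_def using assms(2) by blast
qed

lemma house_edges:
  "{i, j} \<in> edges house \<longleftrightarrow> i < 5 \<and> j < 5 \<and> i \<noteq> j \<and> i \<noteq> Suc j \<and> j \<noteq> Suc i"
  by (auto simp: house_def complement_def path_graph_def doubleton_eq_iff)

context
  fixes G :: "'a graph"
  assumes G: "simple_graph G"
begin

interpretation adjacency "graph_adj G"
  by (rule adjacency_graph_adj[OF G])

section \<open>From forbidden induced subgraphs to adjacency conditions\<close>

lemma bull_free_verts:
  assumes "free_of G bull"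
  shows "bull_free (verts G)"
  unfolding bull_free_def
proof (intro ballI impI, rule ccontr)
  fix a b c d e
  assume V: "a \<in> verts G" "b \<in> verts G" "c \<in> verts G" "d \<in> verts G" "e \<in> verts G"
    and adj: "graph_adj G a b" "graph_adj G a c" "graph_adj G b c" "graph_adj G a d" "graph_adj G b e"
    and non: "\<not> (graph_adj G d b \<or> graph_adj G d c \<or> graph_adj G e a \<or> graph_adj G e c \<or> graph_adj G d e)"
  define g where "g = (!) [a, b, c, d, e]"
  have ne: "a \<noteq> b" "a \<noteq> c" "a \<noteq> d" "a \<noteq> e" "b \<noteq> c" "b \<noteq> d" "b \<noteq> e" "c \<noteq> d" "c \<noteq> e" "d \<noteq> e"
    using adj non adj_irrefl adj_sym by metis+
  have "\<not> free_of G bull"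
  proof (rule not_free_ofI[of g])
    show "inj_on g (verts bull)" using ne by (auto simp: bull_def g_def inj_on_def)
    show "g ` verts bull \<subseteq> verts G" using V by (auto simp: bull_def g_def)
    fix i j assume "i \<in> verts bull" "j \<in> verts bull"
    then have ij: "i \<in> {0, 1, 2, 3, 4}" "j \<in> {0, 1, 2, 3, 4}" by (simp_all add: bull_def)
    have "graph_adj G (g i) (g j) \<longleftrightarrow> {i, j} \<in> edges bull"
      using ij adj non adj_irrefl unfolding bull_def g_def
      by (elim insertE emptyE; simp add: doubleton_eq_iff adj_commute)
    then show "{g i, g j} \<in> edges G \<longleftrightarrow> {i, j} \<in> edges bull" unfolding graph_adj_def .
  qed
  then show False using assms by blast
qed

lemma house_free_verts:
  assumes "free_of G house"
  shows "house_free (verts G)"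
  unfolding house_free_def
proof (intro ballI impI, rule ccontr)
  fix p q r s t
  assume V: "p \<in> verts G" "q \<in> verts G" "r \<in> verts G" "s \<in> verts G" "t \<in> verts G"
    and adj: "graph_adj G p q" "graph_adj G q r" "graph_adj G r s" "graph_adj G s p"
      "graph_adj G t p" "graph_adj G t q"
    and non: "\<not> (graph_adj G p r \<or> graph_adj G q s \<or> graph_adj G t r \<or> graph_adj G t s)"
  \<comment> \<open>The house is the complement of a path, so the list is ordered to make
    consecutive entries exactly the nonadjacent pairs.\<close>
  define g where "g = (!) [p, r, t, s, q]"
  have ne: "p \<noteq> r" "p \<noteq> t" "p \<noteq> s" "p \<noteq> q" "r \<noteq> t" "r \<noteq> s" "r \<noteq> q" "t \<noteq> s" "t \<noteq> q" "s \<noteq> q"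
    using adj non adj_irrefl adj_sym by metis+
  have vs: "verts house = {0, 1, 2, 3, 4}"
    by (auto simp: house_def complement_def path_graph_def)
  have "\<not> free_of G house"
  proof (rule not_free_ofI[of g])
    show "inj_on g (verts house)" using ne by (auto simp: vs g_def inj_on_def)
    show "g ` verts house \<subseteq> verts G" using V by (auto simp: vs g_def)
    fix i j assume "i \<in> verts house" "j \<in> verts house"
    then have ij: "i \<in> {0, 1, 2, 3, 4}" "j \<in> {0, 1, 2, 3, 4}" by (simp_all add: vs)
    have "graph_adj G (g i) (g j) \<longleftrightarrow> {i, j} \<in> edges house"
      using ij adj non adj_irrefl unfolding house_edges g_def
      by (elim insertE emptyE; simp add: adj_commute)
    then show "{g i, g j} \<in> edges G \<longleftrightarrow> {i, j} \<in> edges house" unfolding graph_adj_def .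
  qed
  then show False using assms by blast
qed

lemma hammer_free_verts:
  assumes "free_of G hammer"
  shows "hammer_free (verts G)"
  unfolding hammer_free_def
proof (intro ballI impI, rule ccontr)
  fix a b c d e
  assume V: "a \<in> verts G" "b \<in> verts G" "c \<in> verts G" "d \<in> verts G" "e \<in> verts G"
    and adj: "graph_adj G a b" "graph_adj G a c" "graph_adj G b c" "graph_adj G c d" "graph_adj G d e"
    and non: "\<not> (graph_adj G d a \<or> graph_adj G d b \<or> graph_adj G e a \<or> graph_adj G e b \<or> graph_adj G e c)"
  define g where "g = (!) [a, b, c, d, e]"
  have ne: "a \<noteq> b" "a \<noteq> c" "a \<noteq> d" "a \<noteq> e" "b \<noteq> c" "b \<noteq> d" "b \<noteq> e" "c \<noteq> d" "c \<noteq> e" "d \<noteq> e"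
    using adj non adj_irrefl adj_sym by metis+
  have "\<not> free_of G hammer"
  proof (rule not_free_ofI[of g])
    show "inj_on g (verts hammer)" using ne by (auto simp: hammer_def g_def inj_on_def)
    show "g ` verts hammer \<subseteq> verts G" using V by (auto simp: hammer_def g_def)
    fix i j assume "i \<in> verts hammer" "j \<in> verts hammer"
    then have ij: "i \<in> {0, 1, 2, 3, 4}" "j \<in> {0, 1, 2, 3, 4}" by (simp_all add: hammer_def)
    have "graph_adj G (g i) (g j) \<longleftrightarrow> {i, j} \<in> edges hammer"
      using ij adj non adj_irrefl unfolding hammer_def g_def
      by (elim insertE emptyE; simp add: doubleton_eq_iff adj_commute)
    then show "{g i, g j} \<in> edges G \<longleftrightarrow> {i, j} \<in> edges hammer" unfolding graph_adj_def .
  qed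
  then show False using assms by blast
qed

lemma diamond_free_verts:
  assumes "free_of G diamond"
  shows "diamond_free (verts G)"
  unfolding diamond_free_def
proof (intro ballI impI, rule ccontr)
  fix a b c d
  assume V: "a \<in> verts G" "b \<in> verts G" "c \<in> verts G" "d \<in> verts G"
    and adj: "graph_adj G a b" "graph_adj G a c" "graph_adj G b c" "graph_adj G d b" "graph_adj G d c"
    and non: "a \<noteq> d" "\<not> graph_adj G a d"
  define g where "g = (!) [a, b, c, d]"
  have ne: "a \<noteq> b" "a \<noteq> c" "b \<noteq> c" "d \<noteq> b" "d \<noteq> c"
    using adj adj_irrefl by metis+
  have "\<not> free_of G diamond"
  proof (rule not_free_ofI[of g])
    show "inj_on g (verts diamond)" using ne non by (auto simp: diamond_def g_def inj_on_def)
    show "g ` verts diamond \<subseteq> verts G" using V by (auto simp: diamond_def g_def)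
    fix i j assume "i \<in> verts diamond" "j \<in> verts diamond"
    then have ij: "i \<in> {0, 1, 2, 3}" "j \<in> {0, 1, 2, 3}" by (simp_all add: diamond_def)
    have "graph_adj G (g i) (g j) \<longleftrightarrow> {i, j} \<in> edges diamond"
      using ij adj non adj_irrefl unfolding diamond_def g_def
      by (elim insertE emptyE; simp add: doubleton_eq_iff adj_commute)
    then show "{g i, g j} \<in> edges G \<longleftrightarrow> {i, j} \<in> edges diamond" unfolding graph_adj_def .
  qed
  then show False using assms by blast
qed

lemma triangle_free_induced:
  assumes "triangle_free X"
  shows "free_of (induced G X) triangle"
  unfolding free_of_def
proof (intro notI, elim exE conjE)
  fix Y assume Y: "Y \<subseteq> verts (induced G X)" and "graph_iso (induced (induced G X) Y) triangle"
  then obtain f where f: "bij_betw f Y {0, 1, 2}"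
    and e: "\<And>u v. u \<in> Y \<Longrightarrow> v \<in> Y \<Longrightarrow>
      {u, v} \<in> edges (induced (induced G X) Y) \<longleftrightarrow> {f u, f v} \<in> edges triangle"
    unfolding graph_iso_def by (auto simp: induced_def triangle_def)
  have "f ` Y = {0, 1, 2}" using f by (simp add: bij_betw_def)
  then have "0 \<in> f ` Y" "1 \<in> f ` Y" "2 \<in> f ` Y" by simp_all
  then obtain a b c where abc: "a \<in> Y" "b \<in> Y" "c \<in> Y" "f a = 0" "f b = 1" "f c = 2"
    by (metis imageE)
  then have "graph_adj G a b" "graph_adj G a c" "graph_adj G b c"
    using e[of a b] e[of a c] e[of b c] by (auto simp: induced_def triangle_def graph_adj_def)
  moreover have "Y \<subseteq> X" using Y by (simp add: induced_def)
  ultimately show False using assms abc unfolding triangle_free_def by blast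
qed

section \<open>Clique number, coloring and perfection\<close>

lemma clique_induced: "clique (induced G X) K \<longleftrightarrow> K \<subseteq> X \<and> complete_set K"
  unfolding clique_def complete_set_def graph_adj_def by (auto simp: induced_def)

lemma colorable_induced:
  "colorable (induced G X) k \<longleftrightarrow> (\<exists>c :: 'a \<Rightarrow> nat. (\<forall>x\<in>X. c x < k) \<and>
     (\<forall>x\<in>X. \<forall>y\<in>X. graph_adj G x y \<longrightarrow> c x \<noteq> c y))"
  unfolding colorable_def graph_adj_def by (auto simp: induced_def)

lemma clique_number_induced:
  assumes "finite X"
  shows "\<And>K. K \<subseteq> X \<Longrightarrow> complete_set K \<Longrightarrow> card K \<le> clique_number (induced G X)"
    and "\<exists>K\<subseteq>X. complete_set K \<and> card K = clique_number (induced G X)"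
proof -
  let ?S = "{card K | K. clique (induced G X) K}"
  have eq: "?S = card ` {K. K \<subseteq> X \<and> complete_set K}" unfolding clique_induced by blast
  have "finite {K. K \<subseteq> X \<and> complete_set K}"
    by (rule finite_subset[of _ "Pow X"]) (use assms in auto)
  then have fin: "finite ?S" unfolding eq by (rule finite_imageI)
  show "card K \<le> clique_number (induced G X)" if "K \<subseteq> X" "complete_set K" for K
    unfolding clique_number_def using that by (intro Max_ge[OF fin]) (auto simp: clique_induced)
  have "complete_set {}" unfolding complete_set_def by blast
  then have "?S \<noteq> {}" unfolding eq by blast
  then have "clique_number (induced G X) \<in> ?S" unfolding clique_number_def using Max_in[OF fin] by blast
  then have "clique_number (induced G X) \<in> card ` {K. K \<subseteq> X \<and> complete_set K}"
    unfolding eq .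
  then show "\<exists>K\<subseteq>X. complete_set K \<and> card K = clique_number (induced G X)"
    by auto
qed

text \<open>A largest clique of \<open>X - A\<close> avoids \<open>A\<close>, so it is not maximal
  in \<open>X\<close> and can be enlarged there.\<close>

lemma transversal_decreases_clique_number:
  assumes fin: "finite X" and tr: "transversal X A"
  shows "clique_number (induced G (X - A)) < clique_number (induced G X)"
proof -
  obtain K where K: "K \<subseteq> X - A" "complete_set K" "card K = clique_number (induced G (X - A))"
    using clique_number_induced(2)[of "X - A"] fin by auto
  have "\<not> maximal_clique X K" using K(1) tr unfolding transversal_def by blast
  then obtain x where x: "x \<in> X - K" "\<forall>k\<in>K. graph_adj G x k"
    using K unfolding maximal_clique_def by blast
  then have "complete_set (insert x K)"
    using K(2) adj_sym unfolding complete_set_def by blast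
  moreover have "insert x K \<subseteq> X" using x K(1) by blast
  ultimately have "card (insert x K) \<le> clique_number (induced G X)"
    using clique_number_induced(1)[OF fin] by blast
  moreover have "finite K" using K(1) fin finite_subset by blast
  ultimately show ?thesis using x K(3) by simp
qed

text \<open>A stable transversal serves as one color class; its removal lowers the clique number, so
  the rest is colored by induction with at least one color fewer.\<close>

lemma strongly_perfect_colorable:
  assumes "finite X" "strongly_perfect X"
  shows "colorable (induced G X) (clique_number (induced G X))"
  using assms
proof (induction "card X" arbitrary: X rule: less_induct)
  case less
  show ?case
  proof (cases "X = {}")
    case True
    then show ?thesis unfolding colorable_induced by blast
  next
    case False
    then obtain I where I: "stable I" "transversal X I"
      using less.prems(2) unfolding strongly_perfect_def by blast
    let ?w = "clique_number (induced G X)"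
    have lt: "clique_number (induced G (X - I)) < ?w"
      using transversal_decreases_clique_number[OF less.prems(1) I(2)] .
    have "X - I \<noteq> X" using lt by force
    then have "card (X - I) < card X" using less.prems(1) by (intro psubset_card_mono) auto
    then have "colorable (induced G (X - I)) (clique_number (induced G (X - I)))"
      using less strongly_perfect_mono[OF less.prems(2)] by blast
    then obtain c :: "'a \<Rightarrow> nat" where c: "\<forall>x\<in>X - I. c x < clique_number (induced G (X - I))"
      "\<forall>x\<in>X - I. \<forall>y\<in>X - I. graph_adj G x y \<longrightarrow> c x \<noteq> c y"
      unfolding colorable_induced by blast
    \<comment> \<open>By \<open>lt\<close> the last color \<open>?w - 1\<close> does not occur in
      \<open>c\<close>, and \<open>?w\<close> is positive, so the subtraction is not
      truncated.\<close>
    define c' where "c' x = (if x \<in> I then ?w - 1 else c x)" for x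
    have small: "c x < ?w - 1" if "x \<in> X" "x \<notin> I" for x
    proof -
      have "c x < clique_number (induced G (X - I))" using c(1) that by blast
      then show ?thesis using lt by linarith
    qed
    have "c' x < ?w" if "x \<in> X" for x
      using small[OF that] lt unfolding c'_def by auto
    moreover have "c' x \<noteq> c' y" if xy: "x \<in> X" "y \<in> X" "graph_adj G x y" for x y
    proof -
      consider "x \<in> I" "y \<in> I" | "x \<in> I" "y \<notin> I" | "x \<notin> I" "y \<in> I" | "x \<notin> I" "y \<notin> I" by blast
      then show ?thesis
      proof cases
        case 1
        then show ?thesis using I(1) xy(3) unfolding stable_def by blast
      next
        case 2
        then show ?thesis using small[OF xy(2)] unfolding c'_def by simp
      next
        case 3
        then show ?thesis using small[OF xy(1)] unfolding c'_def by simp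
      next
        case 4
        then show ?thesis using c(2) xy unfolding c'_def by simp
      qed
    qed
    ultimately show ?thesis unfolding colorable_induced by blast
  qed
qed

lemma clique_number_le_colorable:
  assumes "finite X" "colorable (induced G X) k"
  shows "clique_number (induced G X) \<le> k"
proof -
  obtain K where K: "K \<subseteq> X" "complete_set K" "card K = clique_number (induced G X)"
    using clique_number_induced(2)[OF assms(1)] by blast
  obtain c :: "'a \<Rightarrow> nat" where c: "\<forall>x\<in>X. c x < k" "\<forall>x\<in>X. \<forall>y\<in>X. graph_adj G x y \<longrightarrow> c x \<noteq> c y"
    using assms(2) unfolding colorable_induced by blast
  have "inj_on c K" using K c(2) unfolding complete_set_def inj_on_def by (metis subsetD)
  moreover have "c ` K \<subseteq> {..<k}" using c(1) K(1) by blast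
  ultimately have "card K \<le> card {..<k}" by (meson card_inj_on_le finite_lessThan)
  then show ?thesis using K(3) by simp
qed

lemma strongly_perfect_imp_perfect:
  assumes "finite X" "strongly_perfect X"
  shows "perfect (induced G X)"
  unfolding perfect_def
proof (intro allI impI)
  fix Y assume "Y \<subseteq> verts (induced G X)"
  then have Y: "Y \<subseteq> X" by (simp add: induced_def)
  then have eq: "induced (induced G X) Y = induced G Y" by (auto simp: induced_def)
  have "finite Y" "strongly_perfect Y"
    using finite_subset[OF Y assms(1)] strongly_perfect_mono[OF assms(2) Y] by auto
  then show "chromatic_number (induced (induced G X) Y) = clique_number (induced (induced G X) Y)"
    unfolding eq chromatic_number_def
    by (intro Least_equality strongly_perfect_colorable clique_number_le_colorable)
qed

lemma perfectly_divisible_bull_free: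
  assumes bf: "free_of G bull" and H: "free_of G H" "H \<in> {house, hammer, diamond}"
    and col: "\<And>X. X \<subseteq> verts G \<Longrightarrow> free_of (induced G X) triangle \<Longrightarrow> colorable (induced G X) 3"
  shows "perfectly_divisible G"
  unfolding perfectly_divisible_def
proof (intro allI impI)
  fix X assume X: "X \<subseteq> verts G" "X \<noteq> {}"
  have "finite (verts G)" using G unfolding simple_graph_def by blast
  then have fin: "finite X" by (rule finite_subset[OF X(1)])
  have bV: "bull_free (verts G)" using bull_free_verts[OF bf] .
  have hV: "house_free (verts G) \<or> hammer_free (verts G) \<or> diamond_free (verts G)"
    using H house_free_verts hammer_free_verts diamond_free_verts by auto
  have 1: "bull_free X" using bull_free_subset[OF bV X(1)] .
  have 2: "house_free X \<or> hammer_free X \<or> diamond_free X"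
    using hV house_free_subset[OF _ X(1)] hammer_free_subset[OF _ X(1)] diamond_free_subset[OF _ X(1)]
    by blast
  have 3: "three_colorable Y" if "Y \<subseteq> X" "triangle_free Y" for Y
    using col[of Y] triangle_free_induced[OF that(2)] that(1) X(1)
    unfolding colorable_induced three_colorable_def by blast
  obtain A where A: "strongly_perfect A" "transversal X A"
    using strongly_perfect_transversal_exists[OF fin X(2) 1 2 3] by blast
  have "A \<subseteq> X" using A(2) unfolding transversal_def by blast
  then have "A \<union> (X - A) = X" "A \<inter> (X - A) = {}" "finite A"
    using fin finite_subset by blast+
  moreover have "perfect (induced G A)" using strongly_perfect_imp_perfect \<open>finite A\<close> A(1) by blast
  ultimately show "\<exists>A B. A \<union> B = X \<and> A \<inter> B = {} \<and> perfect (induced G A) \<and>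
      clique_number (induced G B) < clique_number (induced G X)"
    using transversal_decreases_clique_number[OF fin A(2)] by blast
qed

end

theorem theorem5:
  fixes H :: "nat graph"
  assumes "H \<in> {house, hammer, diamond}"
  shows "perfect_pollyanna (free_class bull H :: 'a graph set)"
  unfolding perfect_pollyanna_def
proof (intro allI impI ballI)
  fix \<G> :: "'a graph set" and G
  assume \<G>: "hereditary \<G> \<and> (\<forall>G\<in>\<G>. free_of G triangle \<longrightarrow> colorable G 3)"
    and "G \<in> free_class bull H \<inter> \<G>"
  then have G: "simple_graph G" "free_of G bull" "free_of G H" "G \<in> \<G>"
    unfolding free_class_def by auto
  \<comment> \<open>Heredity carries the coloring hypothesis to the triangle-free induced subgraphs
    of \<open>G\<close>.\<close>
  have "induced G X \<in> \<G>" if "X \<subseteq> verts G" for X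
    using \<G> G(4) that unfolding hereditary_def by blast
  then show "perfectly_divisible G"
    using perfectly_divisible_bull_free[OF G(1-3) assms] \<G> by blast
qed

end
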